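(* Let $\mathcal H$ be an infinite-dimensional complex Hilbert space, let $m,p,q\ge1$ be integers, and let $\mathbf A=(A_1,\dots,A_m)$ be an $m$-tuple of bounded self-adjoint operators on $\mathcal H$. Then $$\Lambda^{ess}_{p,q}(\mathbf A)=\bigcap\{\mathbf{cl}(\Lambda_{p,q}(\mathbf A+\mathbf G)):\mathbf G\in\mathcal S_{\mathcal K}(\mathcal H)^m\},$$ where $\mathcal S_{\mathcal K}(\mathcal H)$ is the set of self-adjoint compact operators on $\mathcal H$ and $\mathbf A+\mathbf G=(A_1+G_1,\dots,A_m+G_m)$.
   Context: Let $\mathbf M_q$ be the space of $q\times q$ complex matrices; $\mathbf{cl}$ denotes closure in $\mathbf M_q^m$. For bounded operators $\mathbf A=(A_1,\dots,A_m)$ on $\mathcal H$ and positive integers $p,q$, the joint $(p,q)$-matricial range $\Lambda_{p,q}(\mathbf A)$ is the set of all $(B_1,\dots,B_m)\in\mathbf M_q^m$ for which there is a linear isometry $X:\mathbb C^p\otimes\mathbb C^q\to\mathcal H$ with $X^*A_jX=I_p\otimes B_j$ for all $j$ (the same $X$ for all $j$). The joint essential $(p,q)$-matricial range is defined with finite rank perturbations: $$\Lambda^{ess}_{p,q}(\mathbf A)=\bigcap\{\mathbf{cl}(\Lambda_{p,q}(A_1+F_1,\dots,A_m+F_m)):F_1,\dots,F_m\in\mathcal B(\mathcal H)\text{ of finite rank}\}.$$ *)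

theory Defs
  imports "HOL-Analysis.Analysis"
begin

text \<open>
  Complex Hilbert spaces as type classes. The complex inner product is conjugate-linear in its
  first argument.
\<close>

class complex_vector = real_vector +
  fixes scaleC :: "complex \<Rightarrow> 'a \<Rightarrow> 'a"  (infixr "*\<^sub>C" 75)
  assumes scaleC_add_right: "c *\<^sub>C (x + y) = c *\<^sub>C x + c *\<^sub>C y"
    and scaleC_add_left: "(c + d) *\<^sub>C x = c *\<^sub>C x + d *\<^sub>C x"
    and scaleC_scaleC: "c *\<^sub>C (d *\<^sub>C x) = (c * d) *\<^sub>C x"
    and scaleC_one: "1 *\<^sub>C x = x"
    and scaleR_scaleC: "r *\<^sub>R x = complex_of_real r *\<^sub>C x"

global_interpretation complex_vector: vector_space "scaleC :: complex \<Rightarrow> 'a \<Rightarrow> 'a::complex_vector"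
  defines cspan = complex_vector.span
  by standard (simp_all add: scaleC_add_right scaleC_add_left scaleC_scaleC scaleC_one)

class complex_inner = complex_vector + real_normed_vector +
  fixes cinner :: "'a \<Rightarrow> 'a \<Rightarrow> complex"
  assumes cinner_commute: "cinner x y = cnj (cinner y x)"
    and cinner_add_right: "cinner x (y + z) = cinner x y + cinner x z"
    and cinner_scaleC_right: "cinner x (c *\<^sub>C y) = c * cinner x y"
    and cinner_self: "cinner x x = complex_of_real ((norm x)\<^sup>2)"

class chilbert_space = complex_inner + complete_space
begin
subclass banach ..
end

instantiation complex :: chilbert_space
begin
definition "scaleC c (z::complex) = c * z"
definition "cinner (w::complex) z = cnj w * z"
instance
  by standard
    (auto simp: scaleC_complex_def cinner_complex_def algebra_simps scaleR_conv_of_real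
      complex_mult_cnj cmod_power2)
end

instantiation vec :: (complex_vector, finite) complex_vector
begin
definition "scaleC c x = (\<chi> i. c *\<^sub>C (x $ i))"
instance
  by standard
    (simp_all add: vec_eq_iff scaleC_vec_def scaleC_add_right scaleC_add_left scaleC_scaleC
      scaleC_one scaleR_scaleC)
end

instantiation vec :: (complex_inner, finite) complex_inner
begin
definition "cinner x y = (\<Sum>i\<in>UNIV. cinner (x $ i) (y $ i))"
instance
proof
  fix x y z :: "('a, 'b) vec" and c :: complex
  show "cinner x y = cnj (cinner y x)"
    by (simp add: cinner_vec_def cinner_commute[symmetric])
  show "cinner x (y + z) = cinner x y + cinner x z"
    by (simp add: cinner_vec_def cinner_add_right sum.distrib)
  show "cinner x (c *\<^sub>C y) = c * cinner x y"
    by (simp add: cinner_vec_def scaleC_vec_def cinner_scaleC_right sum_distrib_left)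
  show "cinner x x = complex_of_real ((norm x)\<^sup>2)"
    by (simp add: cinner_vec_def cinner_self norm_vec_def L2_set_def sum_nonneg)
qed
end

instance vec :: (chilbert_space, finite) chilbert_space ..

definition infinite_dimensional :: "'h::complex_vector itself \<Rightarrow> bool" where
  "infinite_dimensional _ \<longleftrightarrow> \<not> (\<exists>S::'h set. finite S \<and> cspan S = UNIV)"

definition clinear :: "('a::complex_vector \<Rightarrow> 'b::complex_vector) \<Rightarrow> bool" where
  "clinear f \<longleftrightarrow> (\<forall>x y. f (x + y) = f x + f y) \<and> (\<forall>c x. f (c *\<^sub>C x) = c *\<^sub>C f x)"

definition bounded_clinear :: "('a::complex_inner \<Rightarrow> 'b::complex_inner) \<Rightarrow> bool" where
  "bounded_clinear f \<longleftrightarrow> clinear f \<and> (\<exists>K. \<forall>x. norm (f x) \<le> K * norm x)"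

definition is_adjoint :: "('a::complex_inner \<Rightarrow> 'b::complex_inner) \<Rightarrow> ('b \<Rightarrow> 'a) \<Rightarrow> bool" where
  "is_adjoint f g \<longleftrightarrow> (\<forall>x y. cinner (f x) y = cinner x (g y))"

definition cadj :: "('a::complex_inner \<Rightarrow> 'b::complex_inner) \<Rightarrow> 'b \<Rightarrow> 'a" where
  "cadj f = (THE g. is_adjoint f g)"

definition selfadjoint :: "('h::complex_inner \<Rightarrow> 'h) \<Rightarrow> bool" where
  "selfadjoint f \<longleftrightarrow> bounded_clinear f \<and> is_adjoint f f"

definition finite_rank :: "('h::complex_inner \<Rightarrow> 'h) \<Rightarrow> bool" where
  "finite_rank f \<longleftrightarrow> bounded_clinear f \<and> (\<exists>S. finite S \<and> range f \<subseteq> cspan S)"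

definition compact_operator :: "('h::complex_inner \<Rightarrow> 'h) \<Rightarrow> bool" where
  "compact_operator f \<longleftrightarrow> bounded_clinear f \<and> compact (closure (f ` cball 0 1))"

definition linear_isometry :: "('a::complex_inner \<Rightarrow> 'b::complex_inner) \<Rightarrow> bool" where
  "linear_isometry f \<longleftrightarrow> clinear f \<and> (\<forall>x. norm (f x) = norm x)"

text \<open>
  The tensor product of \<open>complex^'p\<close> and \<open>complex^'q\<close> is realised as \<open>complex^('p \<times> 'q)\<close>.
\<close>

definition tensor_vec :: "complex^'p \<Rightarrow> complex^'q \<Rightarrow> complex^('p \<times> 'q)" where
  "tensor_vec x y = (\<chi> i. x $ fst i * y $ snd i)"

definition tensor_mat ::
  "complex^'p^'p \<Rightarrow> complex^'q^'q \<Rightarrow> complex^('p \<times> 'q)^('p \<times> 'q)" where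
  "tensor_mat A B = (\<chi> i j. A $ fst i $ fst j * B $ snd i $ snd j)"

lemma tensor_mat_tensor_vec:
  fixes A :: "complex^'p::finite^'p" and B :: "complex^'q::finite^'q"
  shows "tensor_mat A B *v tensor_vec x y = tensor_vec (A *v x) (B *v y)"
  by (simp add: vec_eq_iff tensor_mat_def tensor_vec_def matrix_vector_mult_def
      sum_product sum.cartesian_product case_prod_unfold mult_ac)

text \<open>
  The integers \<open>m\<close>, \<open>p\<close>, \<open>q\<close> are the cardinalities of the index types \<open>'m\<close>, \<open>'p\<close>, \<open>'q\<close>;
  \<open>'p\<close> does not occur in the type of the range and is therefore passed explicitly.
\<close>

definition matricial_range ::
  "'p::finite itself \<Rightarrow> ('m::finite \<Rightarrow> 'h::chilbert_space \<Rightarrow> 'h) \<Rightarrow> ((complex^'q::finite^'q)^'m) set"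
where
  "matricial_range _ A =
    {B. \<exists>X :: complex^('p \<times> 'q) \<Rightarrow> 'h. linear_isometry X \<and>
          (\<forall>j. cadj X \<circ> A j \<circ> X = (*v) (tensor_mat (mat 1) (B $ j)))}"

definition ess_matricial_range ::
  "'p::finite itself \<Rightarrow> ('m::finite \<Rightarrow> 'h::chilbert_space \<Rightarrow> 'h) \<Rightarrow> ((complex^'q::finite^'q)^'m) set"
where
  "ess_matricial_range p A =
    (\<Inter>F\<in>{F. \<forall>j. finite_rank (F j)}. closure (matricial_range p (\<lambda>j x. A j x + F j x)))"

text \<open>
  The definite description in \<^const>\<open>cadj\<close> is well defined for the isometries occurring above.
\<close>

lemma is_adjoint_cadj:
  fixes X :: "complex^'n::finite \<Rightarrow> 'h::complex_inner"
  assumes "clinear X"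
  shows "is_adjoint X (cadj X)"
proof -
  have uniq: "g = h" if "is_adjoint X g" "is_adjoint X h" for g h
  proof
    fix y
    have eq: "cinner v (g y) = cinner v (h y)" for v
      using that unfolding is_adjoint_def by metis
    have "cinner (g y - h y) (g y) = cinner (g y - h y) (g y - h y) + cinner (g y - h y) (h y)"
      by (simp flip: cinner_add_right)
    with eq have "cinner (g y - h y) (g y - h y) = 0" by simp
    then show "g y = h y" by (simp add: cinner_self)
  qed
  have sumX: "X (sum f S) = (\<Sum>i\<in>S. X (f i))" if "finite S" for f and S :: "'n set"
  proof -
    have "X 0 = 0"
      using assms unfolding clinear_def by (metis add_cancel_right_right)
    with that assms show ?thesis
      by (induction S) (auto simp: clinear_def)
  qed
  have add_left: "cinner (u + v) w = cinner u w + cinner v w" for u v w :: 'h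
    by (metis cinner_commute cinner_add_right complex_cnj_add)
  have scale_left: "cinner (c *\<^sub>C u) w = cnj c * cinner u w" for c and u w :: 'h
    by (metis cinner_commute cinner_scaleC_right complex_cnj_mult)
  have sum_left: "cinner (sum f S) w = (\<Sum>i\<in>S. cinner (f i) w)"
    if "finite S" for f :: "'n \<Rightarrow> 'h" and S w
  proof -
    have "cinner 0 w = 0" using add_left[of 0 0 w] by simp
    with that show ?thesis by (induction S) (auto simp: add_left)
  qed
  define g where "g y = (\<chi> i. cinner (X (axis i 1)) y)" for y
  have "is_adjoint X g"
    unfolding is_adjoint_def
  proof (intro allI)
    fix x :: "complex^'n" and y
    have "x = (\<Sum>i\<in>UNIV. (x $ i) *\<^sub>C axis i 1)"
      by (simp add: vec_eq_iff scaleC_vec_def scaleC_complex_def axis_def if_distrib cong: if_cong)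
    then have "X x = (\<Sum>i\<in>UNIV. (x $ i) *\<^sub>C X (axis i 1))"
      using sumX[of UNIV "\<lambda>i. (x $ i) *\<^sub>C axis i 1"] assms by (simp add: clinear_def)
    then show "cinner (X x) y = cinner x (g y)"
      by (simp add: sum_left scale_left g_def cinner_vec_def cinner_complex_def)
  qed
  with uniq show ?thesis
    unfolding cadj_def by (metis theI)
qed

end

theory Submission
  imports Defs
begin

text \<open>
  Let \<open>P\<close> be a finite-rank projection and \<open>c\<close> a point of the joint essential numerical range
  of \<open>A\<close>. In both intersections one of the sets comes from the self-adjoint finite-rank
  perturbation \<open>(1 - P) A\<^sub>j (1 - P) + c\<^sub>j P\<close> of \<open>A\<^sub>j\<close>, and in a compression of it the part inside
  the range of \<open>P\<close> can be replaced by fresh vectors orthogonal to \<open>P\<close> and to everything else in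
  sight, on which \<open>A\<^sub>j\<close> is close to \<open>c\<^sub>j\<close>. So a point \<open>B\<close> of either intersection is approximated
  by compressions of \<open>A\<close> orthogonal to any prescribed finite set. A compact or finite-rank
  perturbation \<open>K\<close> is negligible on such compressions; choosing them successively gives
  compressions of \<open>A + K\<close> near \<open>B\<close> that are mutually orthogonal without cross terms, and
  Tverberg's theorem combines finitely many of them into \<open>p\<close> identical ones.
\<close>

subsection \<open>Complex inner product spaces\<close>

lemma cinner_add_left: "cinner (x + y) z = cinner x z + cinner y (z::'a::complex_inner)"
  by (metis cinner_commute cinner_add_right complex_cnj_add)

lemma cinner_scaleC_left: "cinner (c *\<^sub>C x) y = cnj c * cinner x (y::'a::complex_inner)"
  by (metis cinner_commute cinner_scaleC_right complex_cnj_mult)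

lemma cinner_zero_right [simp]: "cinner x (0::'a::complex_inner) = 0"
  using cinner_add_right[of x 0 0] by simp

lemma cinner_zero_left [simp]: "cinner (0::'a::complex_inner) x = 0"
  using cinner_add_left[of 0 0 x] by simp

lemma cinner_minus_right: "cinner x (- y) = - cinner x (y::'a::complex_inner)"
  using cinner_add_right[of x y "- y"] by (simp add: eq_neg_iff_add_eq_0 add.commute)

lemma cinner_minus_left: "cinner (- x) y = - cinner x (y::'a::complex_inner)"
  using cinner_add_left[of x "- x" y] by (simp add: eq_neg_iff_add_eq_0 add.commute)

lemma cinner_diff_right: "cinner x (y - z) = cinner x y - cinner x (z::'a::complex_inner)"
  using cinner_add_right[of x y "- z"] by (simp add: cinner_minus_right)

lemma cinner_diff_left: "cinner (x - y) z = cinner x z - cinner y (z::'a::complex_inner)"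
  using cinner_add_left[of x "- y" z] by (simp add: cinner_minus_left)

lemma cinner_sum_right: "cinner x (sum f I) = (\<Sum>i\<in>I. cinner x (f i :: 'a::complex_inner))"
  by (induction I rule: infinite_finite_induct) (simp_all add: cinner_add_right)

lemma cinner_sum_left: "cinner (sum f I) x = (\<Sum>i\<in>I. cinner (f i :: 'a::complex_inner) x)"
  by (induction I rule: infinite_finite_induct) (simp_all add: cinner_add_left)

lemma cinner_eq_0_commute: "cinner x y = 0 \<longleftrightarrow> cinner y (x::'a::complex_inner) = 0"
  by (metis cinner_commute complex_cnj_zero_iff)

lemma cinner_self_eq_0 [simp]: "cinner x x = 0 \<longleftrightarrow> (x::'a::complex_inner) = 0"
  by (simp add: cinner_self)

lemma norm_eq_1_iff_cinner: "norm x = 1 \<longleftrightarrow> cinner x x = (1 :: complex)" for x :: "'a::complex_inner"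
proof -
  have "norm x = 1 \<longleftrightarrow> (norm x)\<^sup>2 = 1"
    by (metis norm_ge_zero one_power2 power2_eq_imp_eq zero_le_one)
  then show ?thesis
    by (simp add: cinner_self flip: of_real_power)
qed

lemma norm_scaleC: "norm (c *\<^sub>C x) = cmod c * norm (x::'a::complex_inner)"
proof -
  have "complex_of_real ((norm (c *\<^sub>C x))\<^sup>2) = complex_of_real ((cmod c * norm x)\<^sup>2)"
    unfolding cinner_self[symmetric] cinner_scaleC_left cinner_scaleC_right
    by (simp add: cinner_self power_mult_distrib complex_norm_square del: of_real_power)
  then show ?thesis
    by (metis of_real_eq_iff power2_eq_imp_eq norm_ge_zero mult_nonneg_nonneg)
qed

lemma cinner_cauchy_schwarz: "cmod (cinner x y) \<le> norm x * norm (y::'a::complex_inner)"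
proof (cases "x = 0")
  case False
  \<comment> \<open>\<open>a *\<^sub>C x\<close> is the component of \<open>y\<close> along
    \<open>x\<close>; the inequality expresses that the residual \<open>y - a *\<^sub>C x\<close>
    has nonnegative squared norm.\<close>
  define a where "a = cinner x y / complex_of_real ((norm x)\<^sup>2)"
  have na: "norm x \<noteq> 0" using False by simp
  have "cinner x (y - a *\<^sub>C x) = 0"
    using na by (simp add: cinner_diff_right cinner_scaleC_right cinner_self a_def)
  then have "cinner (y - a *\<^sub>C x) (y - a *\<^sub>C x) = cinner y (y - a *\<^sub>C x)"
    by (simp add: cinner_diff_left[of y] cinner_scaleC_left)
  also have "\<dots> = complex_of_real ((norm y)\<^sup>2) - a * cnj (cinner x y)"
    by (simp add: cinner_diff_right cinner_scaleC_right cinner_self flip: cinner_commute)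
  also have "a * cnj (cinner x y) = complex_of_real ((cmod (cinner x y))\<^sup>2 / (norm x)\<^sup>2)"
    by (simp only: a_def complex_norm_square of_real_divide times_divide_eq_left)
  finally have "complex_of_real ((norm (y - a *\<^sub>C x))\<^sup>2)
      = complex_of_real ((norm y)\<^sup>2 - (cmod (cinner x y))\<^sup>2 / (norm x)\<^sup>2)"
    by (simp add: cinner_self)
  then have "0 \<le> (norm y)\<^sup>2 - (cmod (cinner x y))\<^sup>2 / (norm x)\<^sup>2"
    by (metis of_real_eq_iff zero_le_power2)
  then have "(cmod (cinner x y))\<^sup>2 \<le> (norm x * norm y)\<^sup>2"
    using na by (simp add: field_simps power_mult_distrib)
  then show ?thesis
    by (rule power2_le_imp_le) simp
qed simp

lemma clinear_add: "clinear f \<Longrightarrow> f (x + y) = f x + f y"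
  and clinear_scaleC: "clinear f \<Longrightarrow> f (c *\<^sub>C x) = c *\<^sub>C f x"
  by (simp_all add: clinear_def)

lemma clinear_zero: "clinear f \<Longrightarrow> f 0 = 0"
  using clinear_add[of f 0 0] by simp

lemma clinear_minus: "clinear f \<Longrightarrow> f (- x) = - f x"
  using clinear_add[of f x "- x"] clinear_zero[of f]
  by (simp add: eq_neg_iff_add_eq_0 add.commute)

lemma clinear_diff: "clinear f \<Longrightarrow> f (x - y) = f x - f y"
  using clinear_add[of f x "- y"] clinear_minus[of f y] by simp

lemma clinear_sum: "clinear f \<Longrightarrow> f (sum g I) = (\<Sum>i\<in>I. f (g i))"
  by (induction I rule: infinite_finite_induct) (simp_all add: clinear_zero clinear_add)

lemma clinear_add_fun: "clinear f \<Longrightarrow> clinear g \<Longrightarrow> clinear (\<lambda>x. f x + g x)"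
  by (simp add: clinear_def complex_vector.scale_right_distrib algebra_simps)

lemma bounded_clinear_bound:
  assumes "bounded_clinear f"
  obtains K where "K > 0" "\<And>x. norm (f x) \<le> K * norm x"
proof -
  obtain K where K: "\<And>x. norm (f x) \<le> K * norm x"
    using assms by (auto simp: bounded_clinear_def)
  have "norm (f x) \<le> (\<bar>K\<bar> + 1) * norm x" for x
    using K[of x] by (rule order_trans) (intro mult_right_mono, auto)
  then show ?thesis by (intro that[of "\<bar>K\<bar> + 1"]) auto
qed

lemma bounded_clinear_add:
  assumes "bounded_clinear f" "bounded_clinear g"
  shows "bounded_clinear (\<lambda>x. f x + g x)"
proof -
  obtain K L where "\<And>x. norm (f x) \<le> K * norm x" "\<And>x. norm (g x) \<le> L * norm x"
    using assms by (auto simp: bounded_clinear_def)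
  then have "norm (f x + g x) \<le> (K + L) * norm x" for x
    by (metis add_mono distrib_right norm_triangle_le)
  then show ?thesis
    using assms unfolding bounded_clinear_def by (blast intro: clinear_add_fun)
qed

lemma bounded_clinear_compose:
  assumes "bounded_clinear f" "bounded_clinear g"
  shows "bounded_clinear (\<lambda>x. f (g x))"
proof -
  obtain K where K: "K > 0" "\<And>x. norm (f x) \<le> K * norm x"
    using assms(1) bounded_clinear_bound by blast
  obtain L where L: "L > 0" "\<And>x. norm (g x) \<le> L * norm x"
    using assms(2) bounded_clinear_bound by blast
  have "norm (f (g x)) \<le> (K * L) * norm x" for x
    using order_trans[OF K(2)[of "g x"] mult_left_mono[OF L(2)[of x], of K]] K(1)
    by (simp add: mult.assoc)
  moreover have "clinear (\<lambda>x. f (g x))"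
    using assms by (simp add: bounded_clinear_def clinear_def)
  ultimately show ?thesis unfolding bounded_clinear_def by blast
qed

lemma bounded_clinear_scaleC: "bounded_clinear (\<lambda>x. c *\<^sub>C (x::'a::complex_inner))"
  unfolding bounded_clinear_def clinear_def
  by (auto simp: scaleC_add_right norm_scaleC scaleC_scaleC mult.commute intro!: exI[of _ "cmod c"])

lemma bounded_clinear_ident: "bounded_clinear (\<lambda>x::'a::complex_inner. x)"
  using bounded_clinear_scaleC[of 1] by (simp add: scaleC_one)

lemma selfadjoint_add: "selfadjoint f \<Longrightarrow> selfadjoint g \<Longrightarrow> selfadjoint (\<lambda>x. f x + g x)"
  by (simp add: selfadjoint_def bounded_clinear_add is_adjoint_def cinner_add_left cinner_add_right)

lemma selfadjoint_scale: "selfadjoint f \<Longrightarrow> selfadjoint (\<lambda>x. complex_of_real r *\<^sub>C f x)"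
  by (simp add: selfadjoint_def is_adjoint_def cinner_scaleC_left cinner_scaleC_right
      bounded_clinear_compose[OF bounded_clinear_scaleC])

lemma scaleC_minus1: "complex_of_real (-1) *\<^sub>C x = - x"
  using scaleR_scaleC[of "-1" x] by simp

lemma selfadjoint_diff: "selfadjoint f \<Longrightarrow> selfadjoint g \<Longrightarrow> selfadjoint (\<lambda>x. f x - g x)"
  using selfadjoint_add[of f "\<lambda>x. complex_of_real (-1) *\<^sub>C g x"] selfadjoint_scale[of g "-1"]
  by (simp only: scaleC_minus1) simp

lemma selfadjoint_sandwich:
  "selfadjoint f \<Longrightarrow> selfadjoint g \<Longrightarrow> selfadjoint (\<lambda>x. g (f (g x)))"
  by (simp add: selfadjoint_def bounded_clinear_compose[of g] bounded_clinear_compose[of f]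
      is_adjoint_def)

lemma selfadjoint_ident: "selfadjoint (\<lambda>x. x)"
  by (simp add: selfadjoint_def bounded_clinear_ident is_adjoint_def)

section \<open>Orthonormal families, finite-dimensional projections and Gram-Schmidt\<close>

definition orthonormal_on :: "'i set \<Rightarrow> ('i \<Rightarrow> 'h::complex_inner) \<Rightarrow> bool" where
  "orthonormal_on I u \<longleftrightarrow> (\<forall>a\<in>I. \<forall>b\<in>I. cinner (u a) (u b) = (if a = b then 1 else 0))"

definition perp :: "'h::complex_inner set \<Rightarrow> 'h \<Rightarrow> bool" where
  "perp S y \<longleftrightarrow> (\<forall>s\<in>S. cinner s y = 0)"

text \<open>For finite orthonormal \<open>S\<close> this is the orthogonal projection onto
  \<open>cspan S\<close>.\<close>

definition proj :: "'h::complex_inner set \<Rightarrow> 'h \<Rightarrow> 'h" where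
  "proj S x = (\<Sum>e\<in>S. cinner e x *\<^sub>C e)"

abbreviation orthonormal :: "'h::complex_inner set \<Rightarrow> bool" where
  "orthonormal S \<equiv> orthonormal_on S (\<lambda>e. e)"

lemma orthonormal_on_norm: "orthonormal_on I u \<Longrightarrow> a \<in> I \<Longrightarrow> norm (u a) = 1"
  by (simp add: orthonormal_on_def norm_eq_1_iff_cinner)

lemma perp_Un: "perp (S \<union> T) y \<longleftrightarrow> perp S y \<and> perp T y"
  by (auto simp: perp_def)

lemma perp_mono: "perp T y \<Longrightarrow> S \<subseteq> T \<Longrightarrow> perp S y"
  by (auto simp: perp_def)

lemma perp_scaleC: "perp S y \<Longrightarrow> perp S (c *\<^sub>C y)"
  by (simp add: perp_def cinner_scaleC_right)

lemma perp_add: "perp S x \<Longrightarrow> perp S y \<Longrightarrow> perp S (x + y)"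
  by (simp add: perp_def cinner_add_right)

lemma perp_sum: "(\<And>i. i \<in> I \<Longrightarrow> perp S (f i)) \<Longrightarrow> perp S (sum f I)"
  by (simp add: perp_def cinner_sum_right)

lemma perp_cspan:
  assumes "perp S y" "z \<in> cspan S"
  shows "cinner z y = 0"
  using assms(2)
proof (induction rule: complex_vector.span_induct_alt)
  case (step c x z)
  with assms(1) show ?case
    by (simp add: cinner_add_left cinner_scaleC_left perp_def)
qed simp

lemma proj_in_cspan: "proj S x \<in> cspan S"
  unfolding proj_def
  by (intro complex_vector.span_sum complex_vector.span_scale complex_vector.span_base)

lemma cinner_proj:
  assumes "orthonormal S" "finite S" "e \<in> S"
  shows "cinner e (proj S x) = cinner e x"
proof -
  have "cinner e (proj S x) = (\<Sum>f\<in>S. if e = f then cinner f x else 0)"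
    unfolding proj_def cinner_sum_right cinner_scaleC_right
    by (rule sum.cong) (use assms in \<open>auto simp: orthonormal_on_def\<close>)
  also have "\<dots> = cinner e x" using assms by simp
  finally show ?thesis .
qed

lemma perp_diff_proj: "orthonormal S \<Longrightarrow> finite S \<Longrightarrow> perp S (x - proj S x)"
  by (simp add: perp_def cinner_diff_right cinner_proj)

lemma cinner_proj_right: "cinner x (proj S y) = (\<Sum>e\<in>S. cnj (cinner e x) * cinner e y)"
  by (simp add: proj_def cinner_sum_right cinner_scaleC_right mult.commute flip: cinner_commute)

lemma cinner_proj_left: "cinner (proj S x) y = (\<Sum>e\<in>S. cnj (cinner e x) * cinner e y)"
  by (simp add: proj_def cinner_sum_left cinner_scaleC_left)

lemma selfadjoint_proj:
  assumes "finite S"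
  shows "selfadjoint (proj S)"
proof -
  have "norm (proj S x) \<le> (\<Sum>e\<in>S. norm e * norm e) * norm x" for x
  proof -
    have "norm (proj S x) \<le> (\<Sum>e\<in>S. cmod (cinner e x) * norm e)"
      unfolding proj_def by (rule order_trans[OF norm_sum]) (simp add: norm_scaleC)
    also have "\<dots> \<le> (\<Sum>e\<in>S. norm e * norm x * norm e)"
      by (intro sum_mono mult_right_mono cinner_cauchy_schwarz) auto
    finally show ?thesis by (simp add: sum_distrib_left sum_distrib_right mult_ac)
  qed
  moreover have "clinear (proj S)"
    by (simp add: clinear_def proj_def cinner_add_right cinner_scaleC_right scaleC_add_left
        sum.distrib complex_vector.scale_sum_right scaleC_scaleC)
  ultimately show ?thesis
    unfolding selfadjoint_def bounded_clinear_def is_adjoint_def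
    by (auto simp: cinner_proj_left cinner_proj_right)
qed

lemma orthonormal_insert:
  assumes "orthonormal S" "perp S w" "norm w = 1"
  shows "orthonormal (insert w S)"
  using assms by (auto simp: orthonormal_on_def perp_def norm_eq_1_iff_cinner cinner_eq_0_commute[of w])

lemma Gram_Schmidt_step:
  assumes "orthonormal S" "finite S" "x \<noteq> proj S x"
  shows "norm (inverse (norm (x - proj S x)) *\<^sub>R (x - proj S x)) = 1"
    "perp S (inverse (norm (x - proj S x)) *\<^sub>R (x - proj S x))"
  using assms perp_diff_proj[of S x] by (simp_all add: perp_scaleC scaleR_scaleC[of _ "x - proj S x"] norm_scaleC norm_inverse)

text \<open>Trades a finite set for an orthonormal one, for which \<open>proj\<close> is a
  projection; orthogonality to \<open>T\<close> then implies orthogonality to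
  \<open>S\<close>.\<close>

lemma Gram_Schmidt:
  assumes "finite (S :: 'h::complex_inner set)"
  obtains T where "finite T" "orthonormal T" "S \<subseteq> cspan T"
proof -
  have "\<exists>T. finite T \<and> orthonormal T \<and> S \<subseteq> cspan T"
    using assms
  proof (induction S)
    case empty
    show ?case by (intro exI[of _ "{}"]) (simp add: orthonormal_on_def)
  next
    case (insert x S)
    then obtain T where T: "finite T" "orthonormal T" "S \<subseteq> cspan T" by blast
    show ?case
    proof (cases "x = proj T x")
      case True
      then have "x \<in> cspan T" by (metis proj_in_cspan)
      with T show ?thesis by blast
    next
      case False
      define r where "r = x - proj T x"
      define w where "w = inverse (norm r) *\<^sub>R r"
      have w: "orthonormal (insert w T)"
        using T orthonormal_insert Gram_Schmidt_step[OF T(2,1) False] unfolding w_def r_def by blast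
      have "norm r *\<^sub>R w = r" using False by (simp add: w_def r_def)
      then have "x = complex_of_real (norm r) *\<^sub>C w + proj T x"
        by (simp add: r_def scaleR_scaleC)
      moreover have "complex_of_real (norm r) *\<^sub>C w \<in> cspan (insert w T)"
        by (intro complex_vector.span_scale complex_vector.span_base) simp
      moreover have "proj T x \<in> cspan (insert w T)"
        by (meson complex_vector.span_mono proj_in_cspan subset_iff subset_insertI)
      ultimately have "x \<in> cspan (insert w T)"
        by (metis complex_vector.span_add)
      moreover have "S \<subseteq> cspan (insert w T)"
        using T(3) complex_vector.span_mono[of T "insert w T"] by blast
      ultimately show ?thesis using T w by (intro exI[of _ "insert w T"]) auto
    qed
  qed
  then show ?thesis using that by blast
qed

lemma perp_trans: "perp T y \<Longrightarrow> S \<subseteq> cspan T \<Longrightarrow> perp S y"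
  unfolding perp_def[of S] using perp_cspan by blast

text \<open>A vector outside the finite-dimensional span leaves a nonzero residual after projection;
  normalising it gives \<open>w\<close>. All fresh directions come from here.\<close>

lemma exists_unit_perp:
  assumes "infinite_dimensional TYPE('h::complex_inner)" "finite (S :: 'h set)"
  obtains w where "norm w = 1" "perp S w"
proof -
  obtain T where T: "finite T" "orthonormal T" "S \<subseteq> cspan T"
    using Gram_Schmidt[OF assms(2)] .
  have "cspan T \<noteq> UNIV"
    using assms(1) T(1) by (auto simp: infinite_dimensional_def)
  then obtain x where "x \<notin> cspan T" by blast
  then have "x \<noteq> proj T x" by (metis proj_in_cspan)
  from Gram_Schmidt_step[OF T(2,1) this] that perp_trans[OF _ T(3)] show ?thesis by blast
qed

lemma proj_of_cspan:
  assumes "orthonormal T" "finite T" "y \<in> cspan T"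
  shows "proj T y = y"
proof -
  \<comment> \<open>The residual lies in the span and is orthogonal to it, hence orthogonal to
    itself.\<close>
  have "y - proj T y \<in> cspan T"
    by (intro complex_vector.span_diff assms proj_in_cspan)
  then have "cinner (y - proj T y) (y - proj T y) = 0"
    using perp_cspan perp_diff_proj assms by blast
  then show ?thesis by simp
qed

section \<open>Compactness of finite-rank operators\<close>

lemma compact_combinations:
  assumes "finite (S :: 'h::complex_inner set)"
  shows "compact {\<Sum>e\<in>S. c e *\<^sub>C e |c. \<forall>e\<in>S. cmod (c e) \<le> K}"
  using assms
proof (induction S)
  case (insert x S)
  let ?C = "\<lambda>S. {\<Sum>e\<in>S. c e *\<^sub>C e |c. \<forall>e\<in>S. cmod (c e) \<le> K}"
  have "isCont (\<lambda>c. c *\<^sub>C x) a" for a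
  proof -
    have "((\<lambda>c. norm (c - a) * norm x) \<longlongrightarrow> norm (a - a) * norm x) (at a)"
      by (intro tendsto_intros)
    then have "((\<lambda>c. norm (c *\<^sub>C x - a *\<^sub>C x)) \<longlongrightarrow> 0) (at a)"
      by (simp add: norm_scaleC flip: complex_vector.scale_left_diff_distrib)
    then show ?thesis
      by (simp add: isCont_def LIM_zero_iff tendsto_norm_zero_iff)
  qed
  then have "compact ((\<lambda>c. c *\<^sub>C x) ` cball 0 K)"
    by (intro compact_continuous_image continuous_at_imp_continuous_on) auto
  \<comment> \<open>The set for \<open>insert x S\<close> is the Minkowski sum of the multiples of
    \<open>x\<close> by a disc and the set for \<open>S\<close>, both compact.\<close>
  then have "compact {a + b |a b. a \<in> (\<lambda>c. c *\<^sub>C x) ` cball 0 K \<and> b \<in> ?C S}"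
    using insert.IH by (rule compact_sums)
  also have "{a + b |a b. a \<in> (\<lambda>c. c *\<^sub>C x) ` cball 0 K \<and> b \<in> ?C S} = ?C (insert x S)"
    (is "?L = ?R")
  proof
    show "?L \<subseteq> ?R"
    proof clarify
      fix c and d :: complex assume "d \<in> cball 0 K" "\<forall>e\<in>S. cmod (c e) \<le> K"
      moreover have "(\<Sum>e\<in>S. (c(x := d)) e *\<^sub>C e) = (\<Sum>e\<in>S. c e *\<^sub>C e)"
        by (rule sum.cong) (use insert.hyps in auto)
      ultimately show "\<exists>c'. d *\<^sub>C x + (\<Sum>e\<in>S. c e *\<^sub>C e) = (\<Sum>e\<in>insert x S. c' e *\<^sub>C e)
          \<and> (\<forall>e\<in>insert x S. cmod (c' e) \<le> K)"
        using insert.hyps by (intro exI[of _ "c(x := d)"]) auto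
    qed
    show "?R \<subseteq> ?L"
    proof clarify
      fix c assume c: "\<forall>e\<in>insert x S. cmod (c e) \<le> K"
      show "\<exists>a b. (\<Sum>e\<in>insert x S. c e *\<^sub>C e) = a + b \<and> a \<in> (\<lambda>c. c *\<^sub>C x) ` cball 0 K \<and> b \<in> ?C S"
        by (rule exI[of _ "c x *\<^sub>C x"], rule exI[of _ "\<Sum>e\<in>S. c e *\<^sub>C e"])
          (use c insert.hyps in auto)
    qed
  qed
  finally show ?case .
qed simp

text \<open>In an orthonormal basis of a finite-dimensional space containing the range, images of
  unit-ball vectors have coordinates bounded by \<open>K\<close>, so they lie in a compact set of
  combinations.\<close>

lemma finite_rank_imp_compact_operator:
  assumes "finite_rank f"
  shows "compact_operator f"
proof -
  obtain S where S: "finite S" "range f \<subseteq> cspan S"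
    using assms by (auto simp: finite_rank_def)
  obtain T where T: "finite T" "orthonormal T" "S \<subseteq> cspan T"
    using Gram_Schmidt[OF S(1)] .
  have rT: "range f \<subseteq> cspan T"
    using S(2) T(3) by (meson complex_vector.span_minimal complex_vector.subspace_span order_trans)
  have f: "bounded_clinear f" using assms by (simp add: finite_rank_def)
  obtain K where K: "K > 0" "\<And>x. norm (f x) \<le> K * norm x"
    using bounded_clinear_bound[OF f] by blast
  let ?C = "{\<Sum>e\<in>T. c e *\<^sub>C e |c. \<forall>e\<in>T. cmod (c e) \<le> K}"
  have "f ` cball 0 1 \<subseteq> ?C"
  proof clarify
    fix x :: 'a assume "x \<in> cball 0 1"
    then have "norm (f x) \<le> K" using order_trans[OF K(2)[of x] mult_left_mono[of "norm x" 1 K]] K(1) by simp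
    moreover have "cmod (cinner e (f x)) \<le> norm (f x)" if "e \<in> T" for e
      using cinner_cauchy_schwarz[of e "f x"] orthonormal_on_norm[OF T(2) that] by simp
    moreover have "f x = (\<Sum>e\<in>T. cinner e (f x) *\<^sub>C e)"
      using proj_of_cspan[OF T(2,1)] rT by (metis proj_def range_subsetD)
    ultimately show "\<exists>c. f x = (\<Sum>e\<in>T. c e *\<^sub>C e) \<and> (\<forall>e\<in>T. cmod (c e) \<le> K)"
      by (intro exI[of _ "\<lambda>e. cinner e (f x)"]) force
  qed
  then have "closure (f ` cball 0 1) \<subseteq> ?C"
    by (intro closure_minimal compact_imp_closed compact_combinations T)
  then have "compact (closure (f ` cball 0 1))"
    using compact_Int_closed[OF compact_combinations[OF T(1), of K], of "closure (f ` cball 0 1)"]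
    by (simp add: Int_absorb1)
  with f show ?thesis by (simp add: compact_operator_def)
qed

subsection \<open>Tverberg partitions and compressions\<close>

text \<open>The weights belong to indices, not to points, because each index will later carry its
  own orthonormal vectors even if points coincide. The weighted sums form a convex set containing
  all \<open>x n\<close>.\<close>

lemma convex_hull_image_weights:
  fixes x :: "'i \<Rightarrow> 'a::real_vector"
  assumes "finite I" "z \<in> convex hull (x ` I)"
  obtains t where "\<And>n. n \<in> I \<Longrightarrow> 0 \<le> t n" "sum t I = 1" "(\<Sum>n\<in>I. t n *\<^sub>R x n) = z"
proof -
  let ?W = "{\<Sum>n\<in>I. t n *\<^sub>R x n |t. (\<forall>n\<in>I. 0 \<le> t n) \<and> sum t I = 1}"
  have "convex hull (x ` I) \<subseteq> ?W"
  proof (rule hull_minimal)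
    show "x ` I \<subseteq> ?W"
    proof clarify
      fix n assume "n \<in> I"
      with assms(1) show "\<exists>t. x n = (\<Sum>n\<in>I. t n *\<^sub>R x n) \<and> (\<forall>n\<in>I. 0 \<le> t n) \<and> sum t I = 1"
        by (intro exI[of _ "\<lambda>k. if k = n then 1 else 0"])
          (simp add: if_distrib[of "\<lambda>c. c *\<^sub>R _"] cong: if_cong)
    qed
    show "convex ?W"
    proof (rule convexI, clarify)
      fix a b :: real and s t :: "'i \<Rightarrow> real"
      assume "0 \<le> a" "0 \<le> b" "a + b = 1" "\<forall>n\<in>I. 0 \<le> s n" "sum s I = 1"
        "\<forall>n\<in>I. 0 \<le> t n" "sum t I = 1"
      then show "\<exists>r. a *\<^sub>R (\<Sum>n\<in>I. s n *\<^sub>R x n) + b *\<^sub>R (\<Sum>n\<in>I. t n *\<^sub>R x n) = (\<Sum>n\<in>I. r n *\<^sub>R x n)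
          \<and> (\<forall>n\<in>I. 0 \<le> r n) \<and> sum r I = 1"
        by (intro exI[of _ "\<lambda>n. a * s n + b * t n"])
          (simp add: sum.distrib scaleR_left_distrib scaleR_sum_right flip: sum_distrib_left)
    qed
  qed
  with assms(2) that show ?thesis by blast
qed

text \<open>Radon's theorem for a sequence, so that the two parts are disjoint as index sets even
  when points repeat.\<close>

lemma Radon_indexed:
  fixes z :: "nat \<Rightarrow> 'a::euclidean_space"
  obtains M P where "M \<subseteq> {..<DIM('a) + 2}" "P \<subseteq> {..<DIM('a) + 2}" "M \<inter> P = {}"
    "convex hull (z ` M) \<inter> convex hull (z ` P) \<noteq> {}"
proof (cases "inj_on z {..<DIM('a) + 2}")
  case True
  then have "affine_dependent (z ` {..<DIM('a) + 2})"
    by (intro affine_dependent_biggerset) (simp_all add: card_image)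
  then obtain M P where MP: "M \<subseteq> z ` {..<DIM('a) + 2}" "P \<subseteq> z ` {..<DIM('a) + 2}" "M \<inter> P = {}"
    "convex hull M \<inter> convex hull P \<noteq> {}"
    by (rule Radon)
  have "z ` (z -` M \<inter> {..<DIM('a) + 2}) = M" "z ` (z -` P \<inter> {..<DIM('a) + 2}) = P"
    using MP(1,2) by auto
  with MP(3,4) show ?thesis
    by (intro that[of "z -` M \<inter> {..<DIM('a) + 2}" "z -` P \<inter> {..<DIM('a) + 2}"]) auto
next
  case False
  then obtain i j where "i \<noteq> j" "i < DIM('a) + 2" "j < DIM('a) + 2" "z i = z j"
    by (auto simp: inj_on_def)
  \<comment> \<open>Two equal points already give a Radon partition into singletons.\<close>
  then show ?thesis by (intro that[of "{i}" "{j}"]) auto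
qed

text \<open>
  A weak form of Tverberg's theorem: splitting the sequence into \<open>DIM('a) + 2\<close> subsequences and
  applying Radon's theorem to their common hull points doubles the number of parts.
\<close>

lemma Tverberg_power2:
  fixes x :: "nat \<Rightarrow> 'a::euclidean_space"
  shows "\<exists>(I :: nat \<Rightarrow> nat set) z. (\<forall>s<2 ^ k. finite (I s) \<and> z \<in> convex hull (x ` I s)) \<and> disjoint_family_on I {..<2 ^ k}"
proof (induction k arbitrary: x)
  case 0
  show ?case
    by (intro exI[of _ "\<lambda>_. {0}"] exI[of _ "x 0"]) (auto simp: disjoint_family_on_def)
next
  case (Suc k)
  \<comment> \<open>\<open>d\<close> counts the residue classes; class \<open>i\<close> carries the
    subsequence \<open>x (n * d + i)\<close>, and \<open>d\<close> points are what Radon's theorem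
    asks for.\<close>
  define d where "d = DIM('a) + 2"
  have "\<forall>i. \<exists>(I :: nat \<Rightarrow> nat set) z. (\<forall>s<2 ^ k. finite (I s) \<and> z \<in> convex hull ((\<lambda>n. x (n * d + i)) ` I s))
      \<and> disjoint_family_on I {..<2 ^ k}"
    using Suc.IH by blast
  from choice[OF this] obtain I :: "nat \<Rightarrow> nat \<Rightarrow> nat set" where
    "\<forall>i. \<exists>z. (\<forall>s<2 ^ k. finite (I i s) \<and> z \<in> convex hull ((\<lambda>n. x (n * d + i)) ` I i s))
      \<and> disjoint_family_on (I i) {..<2 ^ k}" ..
  from choice[OF this] obtain z where "\<forall>i. (\<forall>s<2 ^ k. finite (I i s)
      \<and> z i \<in> convex hull ((\<lambda>n. x (n * d + i)) ` I i s)) \<and> disjoint_family_on (I i) {..<2 ^ k}" ..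
  then have Iz: "\<And>i s. s < 2 ^ k \<Longrightarrow> finite (I i s)"
      "\<And>i s. s < 2 ^ k \<Longrightarrow> z i \<in> convex hull ((\<lambda>n. x (n * d + i)) ` I i s)"
      "\<And>i. disjoint_family_on (I i) {..<2 ^ k}"
    by simp_all
  obtain M P where MP: "M \<subseteq> {..<d}" "P \<subseteq> {..<d}" "M \<inter> P = {}"
    "convex hull (z ` M) \<inter> convex hull (z ` P) \<noteq> {}"
    unfolding d_def by (rule Radon_indexed)
  then obtain y where y: "y \<in> convex hull (z ` M)" "y \<in> convex hull (z ` P)" by blast
  \<comment> \<open>\<open>J M s\<close> merges the \<open>s\<close>-th parts of the residue classes
    in \<open>M\<close>, translated back to indices of the whole sequence.\<close>
  define J where "J M s = {n. n mod d \<in> M \<and> n div d \<in> I (n mod d) s}" for M s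
  have J_finite: "finite (J M s)" if "M \<subseteq> {..<d}" "s < 2 ^ k" for M s
  proof (rule finite_subset)
    show "J M s \<subseteq> (\<Union>i\<in>M. (\<lambda>n. n * d + i) ` I i s)"
      unfolding J_def by (force simp: image_iff)
    show "finite (\<Union>i\<in>M. (\<lambda>n. n * d + i) ` I i s)"
      using that Iz(1) finite_subset by blast
  qed
  have J_hull: "y \<in> convex hull (x ` J M s)"
    if "M \<subseteq> {..<d}" "s < 2 ^ k" "y \<in> convex hull (z ` M)" for M s y
  proof -
    have "z i \<in> convex hull (x ` J M s)" if "i \<in> M" for i
    proof -
      have "i < d" using that \<open>M \<subseteq> {..<d}\<close> by blast
      then have "(\<lambda>n. x (n * d + i)) ` I i s \<subseteq> x ` J M s"
        using that by (auto simp: J_def)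
      then show ?thesis using Iz(2)[OF \<open>s < 2 ^ k\<close>, of i] hull_mono by blast
    qed
    then have "convex hull (z ` M) \<subseteq> convex hull (x ` J M s)"
      by (intro hull_minimal convex_convex_hull) auto
    with that(3) show ?thesis by blast
  qed
  \<comment> \<open>The first \<open>2 ^ k\<close> parts are built on \<open>M\<close> and the
    remaining \<open>2 ^ k\<close> on \<open>P\<close>.\<close>
  define L where "L s = (if s < 2 ^ k then J M s else J P (s - 2 ^ k))" for s
  have "finite (L s) \<and> y \<in> convex hull (x ` L s)" if "s < 2 ^ Suc k" for s
    using that J_finite J_hull MP(1,2) y by (simp add: L_def)
  moreover have "disjoint_family_on L {..<2 ^ Suc k}"
    unfolding disjoint_family_on_def
  proof (intro ballI impI, rule ccontr)
    fix s t :: nat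
    assume st: "s \<in> {..<2 ^ Suc k}" "t \<in> {..<2 ^ Suc k}" "s \<noteq> t" "L s \<inter> L t \<noteq> {}"
    then obtain n where n: "n \<in> L s" "n \<in> L t" by blast
    have disj: "s = t" if "n div d \<in> I (n mod d) s" "n div d \<in> I (n mod d) t" "s < 2 ^ k" "t < 2 ^ k"
      for s t
      using Iz(3)[of "n mod d"] that by (auto simp: disjoint_family_on_def)
    have "s = t" if "n div d \<in> I (n mod d) (s - 2 ^ k)" "n div d \<in> I (n mod d) (t - 2 ^ k)"
      "\<not> s < 2 ^ k" "\<not> t < 2 ^ k"
    proof -
      have "s - 2 ^ k = t - 2 ^ k"
        using st(1,2) that by (intro disj) auto
      with that(3,4) show ?thesis by linarith
    qed
    \<comment> \<open>Overlaps within one half contradict disjointness inside a residue class;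
      overlaps across the halves contradict the disjointness of \<open>M\<close> and
      \<open>P\<close>.\<close>
    then show False
      using n st(3) MP(3) disj[of s t]
      by (auto simp: L_def J_def split: if_splits)
  qed
  ultimately show ?case by blast
qed

text \<open>Dependent choice in which each family avoids the finite sets \<open>D x\<close> of all
  earlier vectors \<open>x\<close>. Letting \<open>D x\<close> contain \<open>x\<close> and its
  images under operators removes inner products and cross terms with earlier vectors.\<close>

lemma exists_successively_perp:
  fixes R :: "('a::finite \<Rightarrow> 'h::complex_inner) \<Rightarrow> bool" and D :: "'h \<Rightarrow> 'h set"
  assumes ex: "\<And>T. finite T \<Longrightarrow> \<exists>v. R v \<and> (\<forall>a. perp T (v a))" and fin: "\<And>x. finite (D x)"
  obtains v :: "nat \<Rightarrow> 'a \<Rightarrow> 'h"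
  where "\<And>n. R (v n)" "\<And>n k a b. k < n \<Longrightarrow> perp (D (v k b)) (v n a)"
proof -
  \<comment> \<open>A state pairs the finite set to be avoided with the family chosen orthogonal to
    it.\<close>
  define P where "P S \<longleftrightarrow> finite (fst S) \<and> R (snd S) \<and> (\<forall>a. perp (fst S) (snd S a))"
    for S :: "'h set \<times> ('a \<Rightarrow> 'h)"
  have ex': "\<exists>S'. P S' \<and> fst S' = T" if "finite T" for T
    using ex[OF that] that by (auto simp: P_def)
  have "\<exists>f. \<forall>n::nat. P (f n) \<and> fst (f (Suc n)) = fst (f n) \<union> (\<Union>b. D (snd (f n) b))"
  proof (rule dependent_nat_choice)
    show "\<exists>S. P S" using ex'[of "{}"] by blast
    show "\<exists>S'. P S' \<and> fst S' = fst S \<union> (\<Union>b. D (snd S b))" if "P S" for S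
      using that fin by (intro ex') (simp add: P_def)
  qed
  then obtain f where f: "\<And>n::nat. P (f n)"
    "\<And>n. fst (f (Suc n)) = fst (f n) \<union> (\<Union>b. D (snd (f n) b))" by blast
  have mono: "fst (f k) \<subseteq> fst (f n)" if "k \<le> n" for k n
    using that by (rule lift_Suc_mono_le[of "\<lambda>n. fst (f n)", rotated]) (simp add: f(2))
  show ?thesis
  proof (rule that[of "\<lambda>n. snd (f n)"])
    show "R (snd (f n))" for n using f(1) by (simp add: P_def)
    show "perp (D (snd (f k) b)) (snd (f n) a)" if "k < n" for n k a b
    proof -
      have "D (snd (f k) b) \<subseteq> fst (f (Suc k))" by (auto simp: f(2))
      also have "\<dots> \<subseteq> fst (f n)" using that by (intro mono) simp
      finally show ?thesis using f(1)[of n] by (auto simp: P_def intro: perp_mono)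
    qed
  qed
qed

section \<open>Matricial ranges in terms of orthonormal families\<close>

lemma linear_isometry_cinner:
  assumes "linear_isometry X"
  shows "cinner (X x) (X y) = cinner x y"
proof -
  have X: "clinear X" "\<And>x. norm (X x) = norm x"
    using assms by (auto simp: linear_isometry_def)
  \<comment> \<open>Polarisation: \<open>X\<close> preserves the squared norm of
    \<open>x + c *\<^sub>C y\<close> for every scalar \<open>c\<close>.\<close>
  have "c * cinner (X x) (X y) + cnj (c * cinner (X x) (X y)) = c * cinner x y + cnj (c * cinner x y)"
    for c
  proof -
    have expand: "cinner (v + c *\<^sub>C w) (v + c *\<^sub>C w)
        = cinner v v + c * cnj c * cinner w w + (c * cinner v w + cnj c * cinner w v)"
      for v w :: "'z::complex_inner"
      by (simp add: cinner_add_left cinner_add_right cinner_scaleC_left cinner_scaleC_right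
          algebra_simps)
    have "cinner (X (x + c *\<^sub>C y)) (X (x + c *\<^sub>C y)) = cinner (x + c *\<^sub>C y) (x + c *\<^sub>C y)"
      by (simp only: cinner_self X(2))
    moreover have "cinner (X x) (X x) = cinner x x" "cinner (X y) (X y) = cinner y y"
      by (simp_all only: cinner_self X(2))
    ultimately have "c * cinner (X x) (X y) + cnj c * cinner (X y) (X x)
        = c * cinner x y + cnj c * cinner y x"
      by (simp only: clinear_add[OF X(1)] clinear_scaleC[OF X(1)] expand) simp
    then show ?thesis
      by (simp flip: cinner_commute)
  qed
  \<comment> \<open>\<open>c = 1\<close> compares the real parts and \<open>c = \<i>\<close> the
    imaginary parts.\<close>
  from this[of 1] this[of \<i>] show ?thesis
    by (simp add: complex_eq_iff)
qed

lemma cinner_axis_left: "cinner (axis i 1) y = y $ i" for y :: "complex^'n::finite"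
proof -
  have "cinner (axis i 1 $ k) (y $ k) = (if k = i then y $ k else 0)" for k
    by (simp add: cinner_complex_def axis_def)
  then show ?thesis by (simp add: cinner_vec_def)
qed

text \<open>The family \<open>u\<close> consists of the images of the standard basis under the
  isometry, and the compression is read entrywise. Later arguments can then work with inner products
  alone.\<close>

lemma matricial_range_iff:
  fixes T :: "'m::finite \<Rightarrow> 'h::chilbert_space \<Rightarrow> 'h" and B :: "(complex^'q::finite^'q)^'m"
  assumes T: "\<And>j. clinear (T j)"
  shows "B \<in> matricial_range TYPE('p::finite) T \<longleftrightarrow>
    (\<exists>u::'p \<times> 'q \<Rightarrow> 'h. orthonormal_on UNIV u \<and>
      (\<forall>j i a k b. cinner (u (i, a)) (T j (u (k, b))) = (if i = k then B $ j $ a $ b else 0)))"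
proof
  assume "B \<in> matricial_range TYPE('p) T"
  then obtain X :: "complex^('p \<times> 'q) \<Rightarrow> 'h" where X: "linear_isometry X"
    "\<And>j. cadj X \<circ> T j \<circ> X = (*v) (tensor_mat (mat 1) (B $ j))"
    unfolding matricial_range_def by blast
  define u where "u i = X (axis i 1)" for i
  have "is_adjoint X (cadj X)"
    using X(1) by (intro is_adjoint_cadj) (simp add: linear_isometry_def)
  then have "cinner (u i) (T j (u k)) = cinner (axis i 1) ((cadj X \<circ> T j \<circ> X) (axis k 1))" for i j k
    by (simp add: is_adjoint_def u_def)
  moreover have "(M *v axis k 1) $ i = M $ i $ k" for M :: "complex^('p \<times> 'q)^('p \<times> 'q)" and i k
    by (simp add: matrix_vector_mult_def axis_def if_distrib cong: if_cong)
  ultimately have "cinner (u i) (T j (u k)) = tensor_mat (mat 1) (B $ j) $ i $ k" for i j k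
    by (simp add: X(2) cinner_axis_left)
  moreover have "orthonormal_on UNIV u"
    by (auto simp: orthonormal_on_def u_def linear_isometry_cinner[OF X(1)] cinner_axis_left)
      (auto simp: axis_def)
  ultimately show "\<exists>u::'p \<times> 'q \<Rightarrow> 'h. orthonormal_on UNIV u \<and>
      (\<forall>j i a k b. cinner (u (i, a)) (T j (u (k, b))) = (if i = k then B $ j $ a $ b else 0))"
    by (intro exI[of _ u]) (simp add: tensor_mat_def mat_def)
next
  assume "\<exists>u::'p \<times> 'q \<Rightarrow> 'h. orthonormal_on UNIV u \<and>
      (\<forall>j i a k b. cinner (u (i, a)) (T j (u (k, b))) = (if i = k then B $ j $ a $ b else 0))"
  then obtain u :: "'p \<times> 'q \<Rightarrow> 'h" where u: "orthonormal_on UNIV u"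
    "\<And>j i a k b. cinner (u (i, a)) (T j (u (k, b))) = (if i = k then B $ j $ a $ b else 0)"
    by blast
  define X :: "complex^('p \<times> 'q) \<Rightarrow> 'h" where "X v = (\<Sum>i\<in>UNIV. (v $ i) *\<^sub>C u i)" for v
  have cX: "clinear X"
    by (simp add: clinear_def X_def scaleC_vec_def scaleC_complex_def scaleC_add_left sum.distrib
        scaleC_scaleC complex_vector.scale_sum_right)
  have ip: "cinner (u i) (u k) = (if i = k then 1 else 0)" for i k
    using u(1) unfolding orthonormal_on_def by blast
  have "cinner (X v) (X v) = cinner v v" for v
    by (simp add: X_def cinner_sum_left cinner_sum_right cinner_scaleC_left
        cinner_scaleC_right ip cinner_vec_def cinner_complex_def if_distrib[of "(*) _"] mult.commute
        cong: if_cong)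
  then have "norm (X v) = norm v" for v
    by (metis cinner_self norm_ge_zero of_real_eq_iff power2_eq_imp_eq)
  with cX have iso: "linear_isometry X" by (simp add: linear_isometry_def)
  have X_axis: "X (axis i 1) = u i" for i
    by (simp add: X_def axis_def if_distrib[of "\<lambda>c. c *\<^sub>C _"] scaleC_one cong: if_cong)
  have "(cadj X \<circ> T j \<circ> X) v = tensor_mat (mat 1) (B $ j) *v v" for j v
  proof -
    have "(cadj X \<circ> T j \<circ> X) v $ i = (tensor_mat (mat 1) (B $ j) *v v) $ i" for i
    proof -
      have "(cadj X \<circ> T j \<circ> X) v $ i = cinner (u i) (T j (X v))"
        using is_adjoint_cadj[OF cX] unfolding is_adjoint_def
        by (metis X_axis cinner_axis_left comp_apply)
      also have "\<dots> = (\<Sum>k\<in>UNIV. v $ k * cinner (u i) (T j (u k)))"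
        by (simp add: X_def clinear_sum[OF T] clinear_scaleC[OF T] cinner_sum_right cinner_scaleC_right)
      also have "\<dots> = (tensor_mat (mat 1) (B $ j) *v v) $ i"
        unfolding matrix_vector_mult_def vec_lambda_beta
        by (intro sum.cong refl) (use u(2)[of "fst i" "snd i"] in \<open>auto simp: tensor_mat_def mat_def\<close>)
      finally show ?thesis .
    qed
    then show ?thesis by (simp add: vec_eq_iff)
  qed
  with iso show "B \<in> matricial_range TYPE('p) T"
    unfolding matricial_range_def by (auto simp: fun_eq_iff)
qed

subsection \<open>Compressions orthogonal to a finite set\<close>

lemma selfadjoint_clinear: "selfadjoint f \<Longrightarrow> clinear f"
  by (simp add: selfadjoint_def bounded_clinear_def)

lemma selfadjoint_cinner: "selfadjoint f \<Longrightarrow> cinner (f x) y = cinner x (f y)"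
  by (simp add: selfadjoint_def is_adjoint_def)

lemma selfadjoint_cinner_real:
  assumes "selfadjoint f"
  shows "cinner x (f x) = complex_of_real (Re (cinner x (f x)))"
proof -
  have "cinner x (f x) = cnj (cinner x (f x))"
    by (metis assms cinner_commute selfadjoint_cinner)
  then show ?thesis by (simp add: complex_eq_iff)
qed

text \<open>The value sets \<open>W S\<close> of unit vectors orthogonal to \<open>S\<close> are
  uniformly bounded and shrink as \<open>S\<close> grows, so by compactness their closures share a
  point \<open>c\<close>.\<close>

lemma exists_essential_numerical_range_point:
  fixes A :: "'m::finite \<Rightarrow> 'h::complex_inner \<Rightarrow> 'h"
  assumes inf: "infinite_dimensional TYPE('h)" and A: "\<And>j. bounded_clinear (A j)"
  obtains c :: "real^'m" where
    "\<And>S \<epsilon>. finite S \<Longrightarrow> \<epsilon> > 0 \<Longrightarrow>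
      \<exists>w. norm w = 1 \<and> perp S w \<and> (\<forall>j. \<bar>Re (cinner w (A j w)) - c $ j\<bar> < \<epsilon>)"
proof -
  define W where "W S = {(\<chi> j. Re (cinner w (A j w))) :: real^'m |w. norm w = 1 \<and> perp S w}" for S
  have "\<forall>j. \<exists>M. \<forall>x. norm (A j x) \<le> M * norm x"
    using A by (auto simp: bounded_clinear_def)
  then obtain M where M: "\<And>j x. norm (A j x) \<le> M j * norm x" by metis
  have "W S \<subseteq> cball 0 (\<Sum>j\<in>UNIV. M j)" for S
  proof clarsimp
    fix x assume "x \<in> W S"
    then obtain w where w: "x = (\<chi> j. Re (cinner w (A j w)))" "norm w = 1" by (auto simp: W_def)
    have "\<bar>x $ j\<bar> \<le> M j" for j
      using abs_Re_le_cmod[of "cinner w (A j w)"] cinner_cauchy_schwarz[of w "A j w"] M[of j w] w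
      by simp
    then show "norm x \<le> (\<Sum>j\<in>UNIV. M j)"
      by (intro order_trans[OF norm_le_l1_cart] sum_mono)
  qed
  then have closure_W: "closure (W S) \<subseteq> cball 0 (\<Sum>j\<in>UNIV. M j)" for S
    by (intro closure_minimal) auto
  have "cball 0 (\<Sum>j\<in>UNIV. M j) \<inter> (\<Inter>S\<in>Collect finite. closure (W S)) \<noteq> {}"
  proof (rule compact_imp_fip_image)
    fix \<S> :: "'h set set" assume "finite \<S>" "\<S> \<subseteq> Collect finite"
    then have "finite (\<Union>\<S>)" by auto
    then obtain w where w: "norm w = 1" "perp (\<Union>\<S>) w"
      using exists_unit_perp[OF inf] by blast
    define x where "x = (\<chi> j. Re (cinner w (A j w)))"
    \<comment> \<open>The case \<open>S = {}\<close> places \<open>x\<close> in the ball even when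
      the subfamily is empty.\<close>
    have "x \<in> W S" if "S = {} \<or> S \<in> \<S>" for S
      using w that perp_mono[OF w(2), of S] by (auto simp: W_def x_def)
    then have "x \<in> closure (W S)" if "S = {} \<or> S \<in> \<S>" for S
      using that closure_subset by blast
    with closure_W show "cball 0 (\<Sum>j\<in>UNIV. M j) \<inter> (\<Inter>S\<in>\<S>. closure (W S)) \<noteq> {}"
      by blast
  qed auto
  then obtain c where c: "\<And>S. finite S \<Longrightarrow> c \<in> closure (W S)" by blast
  show ?thesis
  proof (rule that)
    fix S :: "'h set" and \<epsilon> :: real assume "finite S" "\<epsilon> > 0"
    then obtain x where x: "x \<in> W S" "dist x c < \<epsilon>"
      using c by (meson closure_approachable)
    then obtain w where w: "x = (\<chi> j. Re (cinner w (A j w)))" "norm w = 1" "perp S w"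
      by (auto simp: W_def)
    have "\<bar>Re (cinner w (A j w)) - c $ j\<bar> < \<epsilon>" for j
      using component_le_norm_cart[of "x - c" j] x(2) by (simp add: w(1) dist_norm)
    with w show "\<exists>w. norm w = 1 \<and> perp S w \<and> (\<forall>j. \<bar>Re (cinner w (A j w)) - c $ j\<bar> < \<epsilon>)" by blast
  qed
qed

text \<open>Each new vector avoids the earlier ones and their images under all \<open>A j\<close>;
  self-adjointness then kills the cross terms in both orders.\<close>

lemma exists_fresh_orthonormal_family:
  fixes A :: "'m::finite \<Rightarrow> 'h::complex_inner \<Rightarrow> 'h" and c :: "real^'m"
  assumes A: "\<And>j. selfadjoint (A j)"
    and c: "\<And>S \<epsilon>. finite S \<Longrightarrow> \<epsilon> > 0 \<Longrightarrow>
      \<exists>w. norm w = 1 \<and> perp S w \<and> (\<forall>j. \<bar>Re (cinner w (A j w)) - c $ j\<bar> < \<epsilon>)"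
    and "finite S" "finite T" "\<epsilon> > 0"
  obtains w :: "'i \<Rightarrow> 'h" where "orthonormal_on T w" "\<And>e. perp S (w e)"
    "\<And>j e. \<bar>Re (cinner (w e) (A j (w e))) - c $ j\<bar> < \<epsilon>"
    "\<And>j e f. e \<in> T \<Longrightarrow> f \<in> T \<Longrightarrow> e \<noteq> f \<Longrightarrow> cinner (w e) (A j (w f)) = 0"
proof -
  \<comment> \<open>Single vectors are chosen here, so the families are indexed by
    \<open>unit\<close>.\<close>
  define R where "R v \<longleftrightarrow> norm (v ()) = 1 \<and> perp S (v ()) \<and>
    (\<forall>j. \<bar>Re (cinner (v ()) (A j (v ()))) - c $ j\<bar> < \<epsilon>)" for v :: "unit \<Rightarrow> 'h"
  define D where "D x = insert x (range (\<lambda>j. A j x))" for x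
  have "\<exists>v. R v \<and> (\<forall>a. perp U (v a))" if U: "finite U" for U
  proof -
    obtain w where "norm w = 1" "perp (S \<union> U) w" "\<forall>j. \<bar>Re (cinner w (A j w)) - c $ j\<bar> < \<epsilon>"
      using c[of "S \<union> U" \<epsilon>] \<open>finite S\<close> U \<open>\<epsilon> > 0\<close> by blast
    then show ?thesis by (intro exI[of _ "\<lambda>_. w"]) (simp add: R_def perp_Un)
  qed
  then obtain v where v: "\<And>n::nat. R (v n)" "\<And>n k a b. k < n \<Longrightarrow> perp (D (v k b)) (v n a)"
    using exists_successively_perp[of R D] by (auto simp: D_def)
  \<comment> \<open>\<open>g\<close> numbers the elements of \<open>T\<close>, so that distinct
    elements receive distinct members of the sequence.\<close>
  obtain g :: "'i \<Rightarrow> nat" where g: "inj_on g T"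
    using finite_imp_inj_to_nat_seg[OF \<open>finite T\<close>] by blast
  have 1: "cinner (v n ()) (v k ()) = 0 \<and> cinner (v n ()) (A j (v k ())) = 0" if "n \<noteq> k" for j n k
  proof (cases "k < n")
    case True
    then have "cinner (v k ()) (v n ()) = 0" "cinner (A j (v k ())) (v n ()) = 0"
      using v(2) by (auto simp: perp_def D_def)
    then show ?thesis by (metis cinner_eq_0_commute)
  next
    case False
    with that have "n < k" by simp
    then have "cinner (v n ()) (v k ()) = 0" "cinner (A j (v n ())) (v k ()) = 0"
      using v(2) by (auto simp: perp_def D_def)
    then show ?thesis by (simp add: selfadjoint_cinner[OF A])
  qed
  have 2: "cinner (v (g e) ()) (v (g f) ()) = 0 \<and> cinner (v (g e) ()) (A j (v (g f) ())) = 0"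
    if "e \<in> T" "f \<in> T" "e \<noteq> f" for j e f
    using that g by (intro 1) (auto simp: inj_on_def)
  have 3: "norm (v n ()) = 1" "perp S (v n ())" "\<bar>Re (cinner (v n ()) (A j (v n ()))) - c $ j\<bar> < \<epsilon>"
    for n j
    using v(1)[of n] by (simp_all add: R_def)
  show ?thesis
    using 2 3 by (intro that[of "\<lambda>e. v (g e) ()"])
      (auto simp: orthonormal_on_def norm_eq_1_iff_cinner)
qed

text \<open>Self-adjoint finite-rank perturbations occur in both intersections, so this form of the
  hypothesis serves both inclusions.\<close>

lemma exists_compression_perp:
  fixes A :: "'m::finite \<Rightarrow> 'h::chilbert_space \<Rightarrow> 'h" and B :: "(complex^'q::finite^'q)^'m"
  assumes inf: "infinite_dimensional TYPE('h)" and A: "\<And>j. selfadjoint (A j)"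
    and B: "\<And>G. (\<And>j. selfadjoint (G j)) \<Longrightarrow> (\<And>j. finite_rank (G j)) \<Longrightarrow>
      B \<in> closure (matricial_range TYPE('p::finite) (\<lambda>j x. A j x + G j x))"
    and S: "finite S" and \<epsilon>: "\<epsilon> > 0"
  shows "\<exists>v::'q \<Rightarrow> 'h. orthonormal_on UNIV v \<and> (\<forall>a. perp S (v a)) \<and>
    (\<forall>j a b. cmod (cinner (v a) (A j (v b)) - B $ j $ a $ b) < \<epsilon>)"
proof -
  obtain c :: "real^'m" where c: "\<And>S \<epsilon>. finite S \<Longrightarrow> \<epsilon> > 0 \<Longrightarrow>
      \<exists>w. norm w = 1 \<and> perp S w \<and> (\<forall>j. \<bar>Re (cinner w (A j w)) - c $ j\<bar> < \<epsilon>)"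
  proof (rule exists_essential_numerical_range_point[OF inf, of A])
    show "bounded_clinear (A j)" for j using A[of j] by (simp add: selfadjoint_def)
  qed blast
  obtain T where T: "finite T" "orthonormal T" "S \<subseteq> cspan T"
    using Gram_Schmidt[OF S] .
  define Q where "Q x = x - proj T x" for x
  have saP: "selfadjoint (proj T)" using T(1) by (rule selfadjoint_proj)
  have saQ: "selfadjoint Q"
    unfolding Q_def[abs_def] by (rule selfadjoint_diff[OF selfadjoint_ident saP])
  have perpQ: "perp T (Q x)" for x unfolding Q_def using T by (intro perp_diff_proj)
  \<comment> \<open>Chosen so that \<open>A j x + G j x\<close> is \<open>Q (A j (Q x))\<close> plus
    \<open>c $ j\<close> times \<open>proj T x\<close>: scalar on the span of \<open>T\<close>, with
    no coupling to the complement.\<close>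
  define G where "G j x = Q (A j (Q x)) + complex_of_real (c $ j) *\<^sub>C proj T x - A j x" for j x
  have saG: "selfadjoint (G j)" for j
    unfolding G_def[abs_def]
    by (rule selfadjoint_diff[OF selfadjoint_add[OF selfadjoint_sandwich[OF A saQ]
            selfadjoint_scale[OF saP]] A])
  have frG: "finite_rank (G j)" for j
  proof -
    let ?U = "T \<union> A j ` T"
    have P: "proj T x \<in> cspan ?U" for x
      using proj_in_cspan complex_vector.span_mono[of T ?U] by blast
    have AP: "A j (proj T x) \<in> cspan ?U" for x
      unfolding proj_def clinear_sum[OF selfadjoint_clinear[OF A]] clinear_scaleC[OF selfadjoint_clinear[OF A]]
      by (intro complex_vector.span_sum complex_vector.span_scale complex_vector.span_base) auto
    \<comment> \<open>Expanding \<open>Q\<close> cancels \<open>A j x\<close>; every remaining term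
      lies in the span of \<open>T\<close> and its image under \<open>A j\<close>.\<close>
    have "G j x = complex_of_real (c $ j) *\<^sub>C proj T x - A j (proj T x) - proj T (A j (Q x))" for x
      by (simp add: G_def Q_def clinear_diff[OF selfadjoint_clinear[OF A]])
    then have "range (G j) \<subseteq> cspan ?U"
      by (auto intro!: complex_vector.span_diff complex_vector.span_scale P AP)
    moreover have "finite ?U" using T by simp
    ultimately show ?thesis using saG[of j] unfolding finite_rank_def selfadjoint_def by blast
  qed
  \<comment> \<open>Half of \<open>\<epsilon>\<close> is kept for approximating \<open>B\<close>;
    the \<open>+ 1\<close> avoids division by zero when \<open>T\<close> is empty.\<close>
  define \<delta> where "\<delta> = \<epsilon> / (2 * (real (card T) + 1))"
  have \<delta>: "\<delta> > 0" using \<epsilon> by (simp add: \<delta>_def)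
  have "real (card T) * \<delta> \<le> \<epsilon> / 2"
    using \<epsilon> by (simp add: \<delta>_def field_simps)
  obtain B' where B': "B' \<in> matricial_range TYPE('p) (\<lambda>j x. A j x + G j x)" "dist B' B < \<epsilon> / 2"
    using B[of G, OF saG frG] \<epsilon> by (meson closure_approachable half_gt_zero)
  have entry: "cmod (B' $ j $ a $ b - B $ j $ a $ b) < \<epsilon> / 2" for j a b
    using B'(2) Finite_Cartesian_Product.norm_nth_le[of "B' - B" j] Finite_Cartesian_Product.norm_nth_le[of "(B' - B) $ j" a]
      Finite_Cartesian_Product.norm_nth_le[of "(B' - B) $ j $ a" b]
    by (simp add: dist_norm)
  have linAG: "clinear (\<lambda>x. A j x + G j x)" for j
    by (intro clinear_add_fun selfadjoint_clinear A saG)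
  obtain u' :: "'p \<times> 'q \<Rightarrow> 'h" where u': "orthonormal_on UNIV u'"
    "\<And>j i a k b. cinner (u' (i, a)) (A j (u' (k, b)) + G j (u' (k, b))) = (if i = k then B' $ j $ a $ b else 0)"
    using B'(1) unfolding matricial_range_iff[OF linAG] by blast
  \<comment> \<open>One of the identical diagonal blocks suffices; \<open>undefined\<close> names an
    arbitrary index in \<open>'p\<close>.\<close>
  define u where "u a = u' (undefined, a)" for a
  have ou: "orthonormal_on UNIV u" using u'(1) by (auto simp: orthonormal_on_def u_def)
  define z where "z a = Q (u a)" for a
  \<comment> \<open>Avoiding \<open>z a\<close> and \<open>A j (z a)\<close> removes the mixed terms
    between \<open>z\<close> and \<open>w\<close>; avoiding \<open>T\<close> keeps the final vectors
    orthogonal to \<open>S\<close>.\<close>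
  obtain w where w: "orthonormal_on T w"
    "\<And>e. perp (T \<union> range z \<union> (\<Union>j. range (\<lambda>a. A j (z a)))) (w e)"
    "\<And>j e. \<bar>Re (cinner (w e) (A j (w e))) - c $ j\<bar> < \<delta>"
    "\<And>j e f. e \<in> T \<Longrightarrow> f \<in> T \<Longrightarrow> e \<noteq> f \<Longrightarrow> cinner (w e) (A j (w f)) = 0"
    by (rule exists_fresh_orthonormal_family[OF A c, of "T \<union> range z \<union> (\<Union>j. range (\<lambda>a. A j (z a)))" T \<delta>])
      (use T(1) \<delta> in auto)
  have zw: "cinner (z a) (w e) = 0" "cinner (A j (z a)) (w e) = 0" "perp T (w e)" for a j e
  proof -
    have "x \<in> T \<union> range z \<union> (\<Union>j. range (\<lambda>a. A j (z a))) \<Longrightarrow> cinner x (w e) = 0" for x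
      using w(2)[of e] unfolding perp_def by blast
    then show "cinner (z a) (w e) = 0" "cinner (A j (z a)) (w e) = 0" "perp T (w e)"
      by (blast, blast, simp add: perp_def)
  qed
  \<comment> \<open>\<open>\<alpha> a e\<close> are the coordinates of \<open>proj T (u a)\<close>;
    \<open>y a\<close> has the same coordinates in the fresh vectors \<open>w e\<close>.\<close>
  define \<alpha> where "\<alpha> a e = cinner e (u a)" for a e
  define y where "y a = (\<Sum>e\<in>T. \<alpha> a e *\<^sub>C w e)" for a
  have zy: "cinner (z a) (y b) = 0" "cinner (y b) (z a) = 0"
    "cinner (z a) (A j (y b)) = 0" "cinner (y b) (A j (z a)) = 0" for a b j
  proof -
    show "cinner (z a) (y b) = 0"
      by (simp add: y_def cinner_sum_right cinner_scaleC_right zw)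
    then show "cinner (y b) (z a) = 0" by (metis cinner_eq_0_commute)
    have "cinner (A j (z a)) (y b) = 0"
      by (simp add: y_def cinner_sum_right cinner_scaleC_right zw)
    then show "cinner (z a) (A j (y b)) = 0" "cinner (y b) (A j (z a)) = 0"
      using selfadjoint_cinner[OF A] cinner_eq_0_commute by metis+
  qed
  \<comment> \<open>Used with the identity for the Gram matrix and with \<open>A j\<close> for the
    compression.\<close>
  have diagonal: "cinner (y a) (f (y b)) = (\<Sum>e\<in>T. cnj (\<alpha> a e) * \<alpha> b e * cinner (w e) (f (w e)))"
    if f: "clinear f" "\<And>e e'. e \<in> T \<Longrightarrow> e' \<in> T \<Longrightarrow> e \<noteq> e' \<Longrightarrow> cinner (w e) (f (w e')) = 0" for f a b
  proof -
    have "cinner (y a) (f (y b)) = (\<Sum>e\<in>T. \<Sum>e'\<in>T. cnj (\<alpha> a e) * \<alpha> b e' * cinner (w e) (f (w e')))"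
      by (simp add: y_def clinear_sum[OF f(1)] clinear_scaleC[OF f(1)] cinner_sum_left cinner_sum_right
          cinner_scaleC_left cinner_scaleC_right sum_distrib_left mult.assoc)
        (subst sum.swap, simp add: mult_ac)
    also have "\<dots> = (\<Sum>e\<in>T. \<Sum>e'\<in>T. if e = e' then cnj (\<alpha> a e) * \<alpha> b e * cinner (w e) (f (w e)) else 0)"
      by (intro sum.cong refl) (use f(2) in auto)
    finally show ?thesis using T(1) by simp
  qed
  define v where "v a = z a + y a" for a
  \<comment> \<open>Passing from \<open>u\<close> to \<open>z\<close> loses the Gram matrix of the
    projected parts, which \<open>y\<close> restores.\<close>
  have zu: "cinner (z a) (z b) = cinner (u a) (u b) - (\<Sum>e\<in>T. cnj (\<alpha> a e) * \<alpha> b e)" for a b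
  proof -
    have "cinner (proj T (u b)) (z a) = 0"
      unfolding z_def by (rule perp_cspan[OF perpQ proj_in_cspan])
    then have "cinner (z a) (proj T (u b)) = 0" by (metis cinner_eq_0_commute)
    then have "cinner (z a) (z b) = cinner (z a) (u b)"
      by (simp add: z_def[of b] Q_def cinner_diff_right)
    then show ?thesis by (simp add: z_def Q_def cinner_diff_left cinner_proj_left \<alpha>_def)
  qed
  have "cinner (v a) (v b) = cinner (u a) (u b)" for a b
  proof -
    have "cinner (y a) (y b) = (\<Sum>e\<in>T. cnj (\<alpha> a e) * \<alpha> b e)"
      by (subst diagonal[of "\<lambda>x. x"]) (use w(1) in \<open>auto simp: orthonormal_on_def clinear_def\<close>)
    then show ?thesis by (simp add: v_def cinner_add_left cinner_add_right zy zu)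
  qed
  with ou have "orthonormal_on UNIV v" by (simp add: orthonormal_on_def)
  moreover have "perp S (v a)" for a
  proof -
    have "perp T (v a)"
      unfolding v_def y_def z_def by (intro perp_add perp_sum perp_scaleC perpQ zw)
    then show ?thesis using T(3) by (rule perp_trans)
  qed
  moreover have "cmod (cinner (v a) (A j (v b)) - B $ j $ a $ b) < \<epsilon>" for j a b
  proof -
    have "A j (u b) + G j (u b) = Q (A j (z b)) + complex_of_real (c $ j) *\<^sub>C proj T (u b)"
      by (simp add: G_def z_def)
    then have "B' $ j $ a $ b = cinner (u a) (Q (A j (z b)) + complex_of_real (c $ j) *\<^sub>C proj T (u b))"
      using u'(2)[of undefined a j undefined b] by (simp add: u_def)
    also have "\<dots> = cinner (z a) (A j (z b)) + (\<Sum>e\<in>T. cnj (\<alpha> a e) * \<alpha> b e * complex_of_real (c $ j))"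
      by (simp add: cinner_add_right cinner_scaleC_right cinner_proj_right \<alpha>_def z_def[of a]
          selfadjoint_cinner[OF saQ] sum_distrib_left mult_ac)
    \<comment> \<open>The two compressions differ only by having
      \<open>cinner (w e) (A j (w e))\<close> in place of \<open>c $ j\<close>.\<close>
    finally have 1: "cinner (v a) (A j (v b)) - B' $ j $ a $ b
        = (\<Sum>e\<in>T. cnj (\<alpha> a e) * \<alpha> b e * (cinner (w e) (A j (w e)) - complex_of_real (c $ j)))"
      using diagonal[OF selfadjoint_clinear[OF A[of j]] w(4), of a b]
      by (simp add: v_def cinner_add_left cinner_add_right clinear_add[OF selfadjoint_clinear[OF A]] zy
          sum_subtractf right_diff_distrib)
    have "cmod (cinner (v a) (A j (v b)) - B' $ j $ a $ b) \<le> (\<Sum>e\<in>T. 1 * 1 * \<delta>)"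
      unfolding 1
    proof (rule sum_norm_le)
      fix e assume e: "e \<in> T"
      \<comment> \<open>Coordinates of unit vectors have modulus at most 1, so each \<open>e\<close>
        contributes at most \<open>\<delta>\<close> to the error.\<close>
      have \<alpha>1: "cmod (\<alpha> a e) \<le> 1" for a
        using cinner_cauchy_schwarz[of e "u a"] orthonormal_on_norm[OF T(2) e]
          orthonormal_on_norm[OF ou, of a] by (simp add: \<alpha>_def)
      have "cmod (cinner (w e) (A j (w e)) - complex_of_real (c $ j)) \<le> \<delta>"
        using w(3)[of e j] selfadjoint_cinner_real[OF A, of "w e" j]
        by (metis less_imp_le norm_of_real of_real_diff)
      with \<alpha>1[of a] \<alpha>1[of b] \<delta> show "cmod (cnj (\<alpha> a e) * \<alpha> b e * (cinner (w e) (A j (w e)) - complex_of_real (c $ j)))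
          \<le> 1 * 1 * \<delta>"
        unfolding norm_mult complex_mod_cnj by (intro mult_mono) auto
    qed
    also have "\<dots> \<le> \<epsilon> / 2" using \<open>real (card T) * \<delta> \<le> \<epsilon> / 2\<close> by simp
    finally show ?thesis
      using entry[of j a b] norm_triangle_ineq[of "cinner (v a) (A j (v b)) - B' $ j $ a $ b" "B' $ j $ a $ b - B $ j $ a $ b"]
      by simp
  qed
  ultimately show ?thesis by blast
qed

subsection \<open>Perturbations\<close>

lemma norm_vec_le_sum: "norm x \<le> (\<Sum>i\<in>UNIV. norm (x $ i))"
  unfolding norm_vec_def by (rule L2_set_le_sum) simp

text \<open>
  Each of the \<open>p\<close> copies is a combination \<open>\<Sum>\<^sub>n \<surd>t\<^sub>n v\<^sub>n\<close>, which compresses \<open>T\<close> to the convex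
  combination \<open>\<Sum>\<^sub>n t\<^sub>n C\<^sub>n\<close>; Tverberg's theorem makes these convex combinations agree.
\<close>

lemma matricial_range_of_block_diagonal:
  fixes T :: "'m::finite \<Rightarrow> 'h::chilbert_space \<Rightarrow> 'h"
    and C :: "nat \<Rightarrow> (complex^'q::finite^'q)^'m" and v :: "nat \<Rightarrow> 'q \<Rightarrow> 'h"
  assumes T: "\<And>j. clinear (T j)"
    and v: "\<And>n k a b. cinner (v n a) (v k b) = (if n = k \<and> a = b then 1 else 0)"
    and C: "\<And>n k a b j. cinner (v n a) (T j (v k b)) = (if n = k then C n $ j $ a $ b else 0)"
  shows "convex hull (range C) \<inter> matricial_range TYPE('p::finite) T \<noteq> {}"
proof -
  \<comment> \<open>\<open>2 ^ CARD('p)\<close> parts exceed the \<open>CARD('p)\<close> parts that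
    are used, one for each index in \<open>'p\<close>.\<close>
  obtain I :: "nat \<Rightarrow> nat set" and z where "(\<forall>s<2 ^ CARD('p). finite (I s) \<and> z \<in> convex hull (C ` I s))
      \<and> disjoint_family_on I {..<2 ^ CARD('p)}"
    using Tverberg_power2[where x=C and k="CARD('p)"] by (elim exE)
  then have Iz: "\<And>s. s < 2 ^ CARD('p) \<Longrightarrow> finite (I s) \<and> z \<in> convex hull (C ` I s)"
    "disjoint_family_on I {..<2 ^ CARD('p)}"
    by simp_all
  obtain h :: "'p \<Rightarrow> nat" where h: "bij_betw h UNIV {0..<CARD('p)}"
    using ex_bij_betw_finite_nat[of "UNIV :: 'p set"] by auto
  have h_less: "h i < 2 ^ CARD('p)" for i
  proof -
    have "h i < CARD('p)" using h by (auto simp: bij_betw_def)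
    then show ?thesis by (rule less_trans[OF _ less_exp])
  qed
  define L where "L i = I (h i)" for i
  have L: "finite (L i)" "z \<in> convex hull (C ` L i)" for i
    using Iz(1)[OF h_less] by (simp_all add: L_def)
  have L_disj: "L i \<inter> L k = {}" if "i \<noteq> k" for i k
  proof -
    have "h i \<noteq> h k" using h that by (auto simp: bij_betw_def inj_on_def)
    then show ?thesis using Iz(2) h_less by (auto simp: disjoint_family_on_def L_def)
  qed
  have "\<forall>i. \<exists>t. (\<forall>n\<in>L i. 0 \<le> t n) \<and> sum t (L i) = 1 \<and> (\<Sum>n\<in>L i. t n *\<^sub>R C n) = z"
    using convex_hull_image_weights[OF L] by metis
  from choice[OF this] obtain t where
    "\<forall>i. (\<forall>n\<in>L i. 0 \<le> t i n) \<and> sum (t i) (L i) = 1 \<and> (\<Sum>n\<in>L i. t i n *\<^sub>R C n) = z" ..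
  then have t: "\<And>i n. n \<in> L i \<Longrightarrow> 0 \<le> t i n" "\<And>i. sum (t i) (L i) = 1"
    "\<And>i. (\<Sum>n\<in>L i. t i n *\<^sub>R C n) = z"
    by simp_all
  define u where "u = (\<lambda>(i, a). \<Sum>n\<in>L i. complex_of_real (sqrt (t i n)) *\<^sub>C v n a)"
  \<comment> \<open>The two square roots multiply to \<open>t i n\<close>. The identity with
    \<open>\<phi>\<close> constant gives orthonormality; \<open>T j\<close> with the entries of
    \<open>C n\<close> gives the compression.\<close>
  have block: "cinner (u (i, a)) (f (u (k, b)))
      = (if i = k then \<Sum>n\<in>L i. complex_of_real (t i n) * \<phi> n else 0)"
    if f: "clinear f" and \<phi>: "\<And>n m. cinner (v n a) (f (v m b)) = (if n = m then \<phi> n else 0)"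
    for f \<phi> i a k b
  proof -
    have "cinner (u (i, a)) (f (u (k, b))) = (\<Sum>n\<in>L i. \<Sum>m\<in>L k. if n = m
        then complex_of_real (sqrt (t i n)) * complex_of_real (sqrt (t k n)) * \<phi> n else 0)"
      unfolding u_def case_prod_conv clinear_sum[OF f] clinear_scaleC[OF f] cinner_sum_left
        cinner_scaleC_left
      unfolding cinner_sum_right cinner_scaleC_right sum_distrib_left
      by (intro sum.cong refl) (simp add: \<phi>)
    also have "\<dots> = (\<Sum>n\<in>L i. if n \<in> L k
        then complex_of_real (sqrt (t i n)) * complex_of_real (sqrt (t k n)) * \<phi> n else 0)"
      using L(1) by simp
    also have "\<dots> = (if i = k then \<Sum>n\<in>L i. complex_of_real (t i n) * \<phi> n else 0)"
    proof (cases "i = k")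
      case True
      then show ?thesis
        using t(1) by (auto intro!: sum.cong simp flip: of_real_mult)
    next
      case False
      then show ?thesis using L_disj[OF False] by (auto intro!: sum.neutral)
    qed
    finally show ?thesis .
  qed
  have "cinner (u (i, a)) (u (k, b)) = (if i = k \<and> a = b then 1 else 0)" for i a k b
  proof -
    have "cinner (u (i, a)) (u (k, b))
        = (if i = k then \<Sum>n\<in>L i. complex_of_real (t i n) * (if a = b then 1 else 0) else 0)"
      by (rule block[of "\<lambda>x. x"]) (auto simp: clinear_def v)
    then show ?thesis using t(2)[of i] by (auto simp flip: of_real_sum)
  qed
  then have "orthonormal_on UNIV u" by (auto simp: orthonormal_on_def)
  moreover have "cinner (u (i, a)) (T j (u (k, b))) = (if i = k then z $ j $ a $ b else 0)" for i a k b j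
  proof -
    have "z $ j $ a $ b = (\<Sum>n\<in>L i. complex_of_real (t i n) * C n $ j $ a $ b)"
      by (simp add: t(3)[of i, symmetric]) (simp add: scaleR_conv_of_real)
    then show ?thesis using block[where f = "T j" and \<phi> = "\<lambda>n. C n $ j $ a $ b" and i = i and k = k, OF T C]
      by simp
  qed
  ultimately have "z \<in> matricial_range TYPE('p) T"
    unfolding matricial_range_iff[OF T] by blast
  moreover have "z \<in> convex hull (range C)"
    using L(2)[of undefined] hull_mono[of "C ` L undefined" "range C"] by blast
  ultimately show ?thesis by blast
qed

text \<open>
  The maps \<open>Z j\<close> stand in for adjoints of the \<open>K j\<close>, which are only needed off a finite-dimensional
  subspace.
\<close>

lemma in_closure_matricial_range_perturbed:
  fixes A K :: "'m::finite \<Rightarrow> 'h::chilbert_space \<Rightarrow> 'h" and B :: "(complex^'q::finite^'q)^'m"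
  assumes A: "\<And>j. selfadjoint (A j)" and K: "\<And>j. clinear (K j)"
    and compression: "\<And>S \<epsilon>. finite S \<Longrightarrow> \<epsilon> > 0 \<Longrightarrow>
      \<exists>v::'q \<Rightarrow> 'h. orthonormal_on UNIV v \<and> (\<forall>a. perp S (v a)) \<and>
        (\<forall>j a b. cmod (cinner (v a) (A j (v b)) - B $ j $ a $ b) < \<epsilon>)"
    and small: "\<And>\<epsilon>. \<epsilon> > 0 \<Longrightarrow> \<exists>S Z. finite S \<and> (\<forall>j x y. perp S x \<longrightarrow> perp S y \<longrightarrow>
      cinner x (K j y) = cinner (Z j x) y \<and> cmod (cinner x (K j y)) \<le> \<epsilon> * (norm x * norm y))"
  shows "B \<in> closure (matricial_range TYPE('p::finite) (\<lambda>j x. A j x + K j x))"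
  unfolding closure_approachable
proof (intro allI impI)
  fix \<epsilon> :: real assume \<epsilon>: "\<epsilon> > 0"
  \<comment> \<open>The number of scalar entries of \<open>B\<close>: norms are estimated by the sum
    of the moduli of all entries.\<close>
  define N where "N = real CARD('m) * (real CARD('q) * real CARD('q))"
  have N: "N > 0" by (simp add: N_def)
  \<comment> \<open>Each entry errs by at most \<open>2 * \<delta>\<close>, half from the
    compression of \<open>A\<close> and half from \<open>K\<close>, for a total of at most half of
    \<open>\<epsilon>\<close>.\<close>
  define \<delta> where "\<delta> = \<epsilon> / (4 * N)"
  have \<delta>: "\<delta> > 0" "N * (2 * \<delta>) < \<epsilon>" using \<epsilon> N by (simp_all add: \<delta>_def)
  obtain S Z where S: "finite S"
    and Z: "\<And>j x y. perp S x \<Longrightarrow> perp S y \<Longrightarrow> cinner x (K j y) = cinner (Z j x) y"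
    and small': "\<And>j x y. perp S x \<Longrightarrow> perp S y \<Longrightarrow> cmod (cinner x (K j y)) \<le> \<delta> * (norm x * norm y)"
    using small[OF \<delta>(1)] by blast
  define T where "T j x = A j x + K j x" for j x
  have T: "clinear (T j)" for j
    unfolding T_def[abs_def] by (rule clinear_add_fun[OF selfadjoint_clinear[OF A] K])
  define R where "R v \<longleftrightarrow> orthonormal_on UNIV v \<and> (\<forall>a. perp S (v a)) \<and>
    (\<forall>j a b. cmod (cinner (v a) (A j (v b)) - B $ j $ a $ b) < \<delta>)" for v
  \<comment> \<open>\<open>A j x + Z j x\<close> acts as the adjoint of \<open>T j\<close> at
    \<open>x\<close>. Avoiding it together with \<open>T j x\<close> removes the cross terms in both
    orders.\<close>
  define D where "D x = insert x (range (\<lambda>j. T j x) \<union> range (\<lambda>j. A j x + Z j x))" for x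
  have "\<exists>v. R v \<and> (\<forall>a. perp U (v a))" if "finite U" for U
    using compression[of "S \<union> U" \<delta>] S that \<delta>(1) by (auto simp: R_def perp_Un)
  then obtain v where v: "\<And>n::nat. R (v n)" "\<And>n k a b. k < n \<Longrightarrow> perp (D (v k b)) (v n a)"
    using exists_successively_perp[of R D] by (auto simp: D_def)
  have D: "x \<in> D x" "T j x \<in> D x" "A j x + Z j x \<in> D x" for j x
    by (auto simp: D_def)
  have perp_v: "perp S (v n a)" for n a using v(1) by (simp add: R_def)
  have cross: "cinner (v n a) (v k b) = 0 \<and> cinner (v n a) (T j (v k b)) = 0" if "n \<noteq> k" for n k a b j
  proof (cases "k < n")
    case True
    then have "cinner (v k b) (v n a) = 0" "cinner (T j (v k b)) (v n a) = 0"
      using v(2) D unfolding perp_def by blast+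
    then show ?thesis by (metis cinner_eq_0_commute)
  next
    case False
    with that have "n < k" by simp
    then have "cinner (v n a) (v k b) = 0" "cinner (A j (v n a) + Z j (v n a)) (v k b) = 0"
      using v(2) D unfolding perp_def by blast+
    then show ?thesis
      by (simp add: T_def cinner_add_left cinner_add_right selfadjoint_cinner[OF A] Z[OF perp_v perp_v])
  qed
  have orth: "cinner (v n a) (v n b) = (if a = b then 1 else 0)" for n a b
    using v(1)[of n] by (simp add: R_def orthonormal_on_def)
  define C :: "nat \<Rightarrow> (complex^'q^'q)^'m" where "C n = (\<chi> j a b. cinner (v n a) (T j (v n b)))" for n
  have "C n \<in> ball B \<epsilon>" for n
  proof -
    have "cmod (C n $ j $ a $ b - B $ j $ a $ b) \<le> 2 * \<delta>" for j a b
    proof -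
      have "cmod (cinner (v n a) (A j (v n b)) - B $ j $ a $ b) \<le> \<delta>"
        using v(1)[of n] by (simp add: R_def less_imp_le)
      moreover have "norm (v n a) = 1" for a
        by (simp add: norm_eq_1_iff_cinner orth)
      then have "cmod (cinner (v n a) (K j (v n b))) \<le> \<delta>"
        using small'[OF perp_v perp_v, of n a j n b] by simp
      ultimately show ?thesis
        using norm_triangle_ineq[of "cinner (v n a) (A j (v n b)) - B $ j $ a $ b" "cinner (v n a) (K j (v n b))"]
        by (simp add: C_def T_def cinner_add_right algebra_simps)
    qed
    then have "norm (C n - B) \<le> (\<Sum>j\<in>(UNIV::'m set). \<Sum>a\<in>(UNIV::'q set). \<Sum>b\<in>(UNIV::'q set). 2 * \<delta>)"
      by (intro order_trans[OF norm_vec_le_sum] sum_mono) simp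
    also have "\<dots> = N * (2 * \<delta>)" by (simp add: N_def)
    finally show ?thesis using \<delta>(2) by (simp add: dist_norm norm_minus_commute)
  qed
  \<comment> \<open>By convexity of the ball, every convex combination of the \<open>C n\<close>
    stays near \<open>B\<close>, whatever weights Tverberg's theorem yields.\<close>
  then have "convex hull (range C) \<subseteq> ball B \<epsilon>"
    by (intro hull_minimal convex_ball) auto
  moreover have "convex hull (range C) \<inter> matricial_range TYPE('p) T \<noteq> {}"
  proof (rule matricial_range_of_block_diagonal[OF T, where v=v])
    show "cinner (v n a) (v k b) = (if n = k \<and> a = b then 1 else 0)" for n k a b
      by (cases "n = k") (simp_all add: cross orth)
    show "cinner (v n a) (T j (v k b)) = (if n = k then C n $ j $ a $ b else 0)" for n k a b j
      by (cases "n = k") (simp_all add: cross C_def)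
  qed
  ultimately obtain D where "D \<in> matricial_range TYPE('p) T" "D \<in> ball B \<epsilon>" by blast
  then show "\<exists>D\<in>matricial_range TYPE('p) (\<lambda>j x. A j x + K j x). dist D B < \<epsilon>"
    unfolding T_def[abs_def] by (auto simp: dist_commute)
qed

section \<open>Finite-rank and compact operators away from a finite set of vectors\<close>

lemma finite_rank_off_finite:
  fixes F :: "'m::finite \<Rightarrow> 'h::complex_inner \<Rightarrow> 'h"
  assumes "\<And>j. finite_rank (F j)"
  obtains S where "finite S" "\<And>j x y. perp S x \<Longrightarrow> cinner x (F j y) = 0"
proof -
  have "\<forall>j. \<exists>S. finite S \<and> range (F j) \<subseteq> cspan S"
    using assms by (simp add: finite_rank_def)
  then obtain S where S: "\<And>j. finite (S j)" "\<And>j. range (F j) \<subseteq> cspan (S j)" by metis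
  show ?thesis
  proof (rule that)
    show "finite (\<Union>j. S j)" using S(1) by simp
    fix j x y assume "perp (\<Union>j. S j) x"
    then have "perp (S j) x" by (rule perp_mono) auto
    moreover have "F j y \<in> cspan (S j)" using S(2) by blast
    ultimately have "cinner (F j y) x = 0" by (rule perp_cspan)
    then show "cinner x (F j y) = 0" by (metis cinner_eq_0_commute)
  qed
qed

text \<open>\<open>S\<close> collects the centres of finite \<open>\<epsilon>\<close>-nets for the
  images of the unit ball. If \<open>x\<close> is orthogonal to a centre \<open>s\<close> near
  \<open>G j w\<close>, only \<open>G j w - s\<close> contributes to
  \<open>cinner x (G j w)\<close>.\<close>

lemma compact_operator_off_finite:
  fixes G :: "'m::finite \<Rightarrow> 'h::complex_inner \<Rightarrow> 'h"
  assumes G: "\<And>j. compact_operator (G j)" and "\<epsilon> > 0"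
  obtains S where "finite S" "\<And>j x y. perp S x \<Longrightarrow> cmod (cinner x (G j y)) \<le> \<epsilon> * (norm x * norm y)"
proof -
  have "\<exists>S. finite S \<and> G j ` cball 0 1 \<subseteq> (\<Union>s\<in>S. ball s \<epsilon>)" for j
  proof -
    have "compact (closure (G j ` cball 0 1))"
      using G by (simp add: compact_operator_def)
    then obtain S where S: "finite S" "closure (G j ` cball 0 1) \<subseteq> (\<Union>s\<in>S. ball s \<epsilon>)"
      using \<open>\<epsilon> > 0\<close> unfolding compact_eq_totally_bounded by blast
    from S(1) order_trans[OF closure_subset S(2)] show ?thesis by blast
  qed
  then obtain S where S: "\<And>j. finite (S j)" "\<And>j. G j ` cball 0 1 \<subseteq> (\<Union>s\<in>S j. ball s \<epsilon>)"
    by metis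
  show ?thesis
  proof (rule that)
    show "finite (\<Union>j. S j)" using S(1) by simp
    fix j x y assume x: "perp (\<Union>j. S j) x"
    have cl: "clinear (G j)" using G[of j] by (simp add: compact_operator_def bounded_clinear_def)
    show "cmod (cinner x (G j y)) \<le> \<epsilon> * (norm x * norm y)"
    proof (cases "y = 0")
      case True
      then show ?thesis by (simp add: clinear_zero[OF cl])
    next
      case False
      define w where "w = inverse (complex_of_real (norm y)) *\<^sub>C y"
      have "norm w = 1" using False by (simp add: w_def norm_scaleC norm_inverse)
      then have "G j w \<in> (\<Union>s\<in>S j. ball s \<epsilon>)"
        by (intro subsetD[OF S(2)] imageI) simp
      then obtain s where s: "s \<in> S j" "norm (s - G j w) < \<epsilon>"
        by (auto simp: dist_norm)
      have "cinner s x = 0" using x s(1) by (auto simp: perp_def)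
      then have "cinner x s = 0" by (metis cinner_eq_0_commute)
      then have "cmod (cinner x (G j w)) = cmod (cinner x (G j w - s))"
        by (simp add: cinner_diff_right)
      also have "\<dots> \<le> norm x * norm (G j w - s)" by (rule cinner_cauchy_schwarz)
      also have "\<dots> \<le> norm x * \<epsilon>"
        using s(2) by (intro mult_left_mono) (simp_all add: norm_minus_commute)
      finally have 1: "cmod (cinner x (G j w)) \<le> norm x * \<epsilon>" .
      have "y = complex_of_real (norm y) *\<^sub>C w"
        using False by (simp add: w_def scaleC_scaleC scaleC_one)
      then have "cinner x (G j y) = complex_of_real (norm y) * cinner x (G j w)"
        by (metis clinear_scaleC[OF cl] cinner_scaleC_right)
      then have "cmod (cinner x (G j y)) = norm y * cmod (cinner x (G j w))"
        by (simp add: norm_mult)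
      also have "\<dots> \<le> norm y * (norm x * \<epsilon>)" using 1 by (intro mult_left_mono) auto
      finally show ?thesis by (simp add: mult_ac)
    qed
  qed
qed

section \<open>Equality of the two intersections\<close>

theorem proposition4p6:
  fixes A :: "'m::finite \<Rightarrow> 'h::chilbert_space \<Rightarrow> 'h"
  assumes "infinite_dimensional TYPE('h)"
    and "\<And>j. selfadjoint (A j)"
  shows "(ess_matricial_range TYPE('p::finite) A :: ((complex^'q::finite^'q)^'m) set) =
    (\<Inter>G\<in>{G. \<forall>j. selfadjoint (G j) \<and> compact_operator (G j)}.
      closure (matricial_range TYPE('p) (\<lambda>j x. A j x + G j x)))"
proof (intro equalityI subsetI)
  fix B :: "(complex^'q^'q)^'m"
  assume B: "B \<in> ess_matricial_range TYPE('p) A"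
  show "B \<in> (\<Inter>G\<in>{G. \<forall>j. selfadjoint (G j) \<and> compact_operator (G j)}.
      closure (matricial_range TYPE('p) (\<lambda>j x. A j x + G j x)))"
  proof clarify
    fix G :: "'m \<Rightarrow> 'h \<Rightarrow> 'h"
    assume "\<forall>j. selfadjoint (G j) \<and> compact_operator (G j)"
    then have G: "\<And>j. selfadjoint (G j)" "\<And>j. compact_operator (G j)" by auto
    show "B \<in> closure (matricial_range TYPE('p) (\<lambda>j x. A j x + G j x))"
    proof (rule in_closure_matricial_range_perturbed[OF assms(2) selfadjoint_clinear[OF G(1)]])
      show "\<exists>v::'q \<Rightarrow> 'h. orthonormal_on UNIV v \<and> (\<forall>a. perp S (v a)) \<and>
          (\<forall>j a b. cmod (cinner (v a) (A j (v b)) - B $ j $ a $ b) < \<epsilon>)"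
        if "finite S" "\<epsilon> > 0" for S \<epsilon>
      proof (rule exists_compression_perp[where 'p='p, OF assms _ that])
        \<comment> \<open>The essential range allows all finite-rank perturbations, in particular
          the self-adjoint ones.\<close>
        show "B \<in> closure (matricial_range TYPE('p) (\<lambda>j x. A j x + F j x))"
          if "\<And>j. finite_rank (F j)" for F
          using B that by (auto simp: ess_matricial_range_def)
      qed
      show "\<exists>S Z. finite S \<and> (\<forall>j x y. perp S x \<longrightarrow> perp S y \<longrightarrow>
          cinner x (G j y) = cinner (Z j x) y \<and> cmod (cinner x (G j y)) \<le> \<epsilon> * (norm x * norm y))"
        if \<epsilon>: "\<epsilon> > 0" for \<epsilon>
      proof -
        obtain S where "finite S"
          "\<And>j x y. perp S x \<Longrightarrow> cmod (cinner x (G j y)) \<le> \<epsilon> * (norm x * norm y)"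
          using compact_operator_off_finite[of G, OF G(2) \<epsilon>] by blast
        \<comment> \<open>\<open>G\<close> is its own adjoint, so it can be taken for
          \<open>Z\<close>.\<close>
        then show ?thesis
          by (intro exI[of _ S] exI[of _ G]) (simp add: selfadjoint_cinner[OF G(1)])
      qed
    qed
  qed
next
  fix B :: "(complex^'q^'q)^'m"
  assume B: "B \<in> (\<Inter>G\<in>{G. \<forall>j. selfadjoint (G j) \<and> compact_operator (G j)}.
      closure (matricial_range TYPE('p) (\<lambda>j x. A j x + G j x)))"
  show "B \<in> ess_matricial_range TYPE('p) A"
    unfolding ess_matricial_range_def
  proof clarify
    fix F :: "'m \<Rightarrow> 'h \<Rightarrow> 'h"
    assume "\<forall>j. finite_rank (F j)"
    then have F: "\<And>j. finite_rank (F j)" by auto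
    then have cl: "clinear (F j)" for j by (simp add: finite_rank_def bounded_clinear_def)
    show "B \<in> closure (matricial_range TYPE('p) (\<lambda>j x. A j x + F j x))"
    proof (rule in_closure_matricial_range_perturbed[OF assms(2) cl])
      show "\<exists>v::'q \<Rightarrow> 'h. orthonormal_on UNIV v \<and> (\<forall>a. perp S (v a)) \<and>
          (\<forall>j a b. cmod (cinner (v a) (A j (v b)) - B $ j $ a $ b) < \<epsilon>)"
        if "finite S" "\<epsilon> > 0" for S \<epsilon>
      proof (rule exists_compression_perp[where 'p='p, OF assms _ that])
        \<comment> \<open>Self-adjoint finite-rank perturbations are compact, hence occur in the
          second intersection.\<close>
        show "B \<in> closure (matricial_range TYPE('p) (\<lambda>j x. A j x + G j x))"
          if "\<And>j. selfadjoint (G j)" "\<And>j. finite_rank (G j)" for G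
          using B that finite_rank_imp_compact_operator by blast
      qed
      show "\<exists>S Z. finite S \<and> (\<forall>j x y. perp S x \<longrightarrow> perp S y \<longrightarrow>
          cinner x (F j y) = cinner (Z j x) y \<and> cmod (cinner x (F j y)) \<le> \<epsilon> * (norm x * norm y))"
        if "\<epsilon> > 0" for \<epsilon>
      proof -
        obtain S where "finite S" "\<And>j x y. perp S x \<Longrightarrow> cinner x (F j y) = 0"
          using finite_rank_off_finite[of F, OF F] by blast
        \<comment> \<open>\<open>F\<close> may fail to be self-adjoint, but its form vanishes off
          \<open>S\<close>, so zero can be taken for \<open>Z\<close>.\<close>
        then show ?thesis
          using that by (intro exI[of _ S] exI[of _ "\<lambda>_ _. 0"]) simp
      qed
    qed
  qed
qed

end
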